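(* The map $\phi$ (defined in the context) is a bijection between the set of rooted $G(v,t)$-forests and the set of boundary $r$-paths in $\tilde N_{(v,t)}$, $r\geq 0$. Moreover, for every rooted $G(v,t)$-forest $F$, \[ \mathrm{wt}(F)=\mathrm{wt}(\phi(F))\cdot W_{(v,t)},\qquad W_{(v,t)}=\frac{x_{a_1}x_{a_3}\cdots x_{a_{2t-1}}}{x_{a_2}x_{a_4}\cdots x_{a_{2t-2}}}. \]
   Context: Let $\mathbb{P}_0=\{(i,j,k)\in\mathbb{Z}^3:i+j+k=0\}$ (a triangular lattice in the plane), $e_{12}=(1,-1,0)$, $e_{23}=(0,1,-1)$, $e_{31}=(-1,0,1)$; for $v=(i,j,k)$ its color $\epsilon_v\in\{0,1,2\}$ satisfies $\epsilon_v\equiv j-k\pmod3$ (colors $0,1,2$: red, green, blue). To each $u\in\mathbb{P}_0$ is attached an indeterminate $x_u$. Let $G$ be the planar graph on $\mathbb{P}_0$ with edges $(u,u+e_{12}),(u,u+e_{23}),(u,u+e_{31})$ for every $u$ with $\epsilon_u\neq0$; its bounded faces are lozenges, each with one red vertex $d_L$, one blue vertex $b_L$ and two green vertices $a_L,c_L$; its diagonals are $\{b_L,d_L\}$ and $\{a_L,c_L\}$; let $e_L$ denote its center. Fix $v\in\mathbb{P}_0$ and an integer $t\ge2$ with $t+1\equiv\epsilon_v\pmod 3$. Let $\Delta(v,t)$ be the convex hull of $v+te_{12},v+te_{23},v+te_{31}$, and $G(v,t)$ the subgraph of $G$ consisting of all lozenges of $G$ lying inside $\Delta(v,t)$, with vertex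 set $\mathrm{Vert}(v,t)$. Its boundary vertices (those on the outer face) form the set $\partial G(v,t)$, listed counterclockwise as $a_1,\dots,a_{2t-1}=b_1,\dots,b_{2t-1}=c_1,\dots,c_{2t-1}=a_1$, where for $1\le i\le t-1$: $a_{2i}=v+(i,t-2i,i-t)$, $b_{2i}=v+(t-2i,i-t,i)$, $c_{2i}=v+(i-t,i,t-2i)$, and for $0\le i\le t-1$: $a_{2i+1}=v+(i,t-1-2i,i-t+1)$, $b_{2i+1}=v+(t-1-2i,i-t+1,i)$, $c_{2i+1}=v+(i-t+1,i,t-1-2i)$. A $G(v,t)$-forest is a forest $F$ with vertex set $\mathrm{Vert}(v,t)$ containing, for each lozenge of $G(v,t)$, exactly one of its two diagonals, and no other edges. Its weight is $\mathrm{wt}(F)=\prod_{u\in\mathrm{Vert}(v,t)}x_u^{\deg_F(u)-2+s(u)}$, where $s(u)=0$ for $u\notin\partial G(v,t)$, $s(a_1)=s(b_1)=s(c_1)=2$, and $s(a_i)=s(b_i)=s(c_i)=1$ for $2\le i\le 2t-2$. A rooted $G(v,t)$-forest is a $G(v,t)$-forest together with a choice, for each connected component $C$, of a vertex $s_C\in C\cap\partial G(v,t)$ (the root); its edges are oriented towards the root of their component. The network $\tilde N_{(v,t)}$ is the directed graph with vertex set $\mathrm{Vert}(v,t)$ together with the centers $e_L$ of all lozenges $L$ of $G(v,t)$, and, for each such $L$, edges $a_L\to e_L$ and $c_L\to e_L$ of weight $\alpha_L=\frac{x_{a_L}x_{c_L}}{x_{b_L}x_{d_L}}$ and edges $b_L\to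 e_L$, $e_L\to d_L$ of weight $1$. A boundary $r$-path is an $r$-tuple of pairwise vertex-disjoint directed paths in $\tilde N_{(v,t)}$, each starting and ending at vertices of $\partial G(v,t)$; it is identified with its set of edges, and its weight is the product of the weights of its edges (the empty $0$-path has weight $1$). The map $\phi$: given a rooted $G(v,t)$-forest $F$, for each lozenge $L$ of $G(v,t)$ let $u\to w$ be the oriented edge of $F$ in $L$; if $u=d_L$, no edges inside $L$ are taken; otherwise the edges $u\to e_L$ and $e_L\to d_L$ are taken. $\phi(F)$ is the set of all taken edges.
   Formalization: Corner names depend on the lozenge's direction ({b_L,d_L} is the diagonal most nearly parallel to the side a_1…a_{2t-1}, with d_L towards a_1) instead of d_L red and b_L blue; boundary paths must start at boundary vertices that are sources of the network. *)

theory Defs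
  imports "HOL-Analysis.Analysis" "HOL-Library.FuncSet"
begin

section \<open>The triangular lattice and the graph G\<close>

type_synonym vec3 = "int \<times> int \<times> int"

definition P0 :: "vec3 set" where
  "P0 = {(i, j, k). i + j + k = 0}"

abbreviation e12 :: vec3 where "e12 \<equiv> (1, -1, 0)"
abbreviation e23 :: vec3 where "e23 \<equiv> (0, 1, -1)"
abbreviation e31 :: vec3 where "e31 \<equiv> (-1, 0, 1)"

fun color :: "vec3 \<Rightarrow> int" where
  "color (i, j, k) = (j - k) mod 3"

definition G_edges :: "vec3 set set" where
  "G_edges = {{u, u + e} | u e. u \<in> P0 \<and> color u \<noteq> 0 \<and> e \<in> {e12, e23, e31}}"

text \<open>
  The edges of the triangular lattice that are missing in G are exactly those joining a red vertex
  r to a blue vertex r + e with e one of e12, e23, e31.  Removing such an edge merges the two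
  lattice triangles containing it into one face of G, so the bounded faces of G correspond to the
  pairs (r, e).  The other two corners of that face are the common lattice neighbours
  r - e' and r - e'' of r and r + e, where {e, e', e''} = {e12, e23, e31}; both are green.
\<close>

datatype dir = D12 | D23 | D31

datatype lozenge = Loz (red: vec3) (rbdir: dir)

definition lozenges :: "lozenge set" where
  "lozenges = {L. red L \<in> P0 \<and> color (red L) = 0}"

text \<open>
  The corners of a lozenge L are named so that {a_L, c_L} and {b_L, d_L} are its two diagonals.
  Which diagonal is {b_L, d_L}, and which of its ends is d_L, depends on the type of the lozenge:
  {b_L, d_L} is the diagonal that makes an angle of at most 30 degrees with the side
  a_1, ..., a_(2t-1) of the region below (the other diagonal makes an angle of at least 60 degrees
  with it), and b_L -> d_L points in the direction from a_(2t-1) to a_1, that is, along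
  e23 - e12.  Hence {b_L, d_L} is the red-blue diagonal for the types D12 and D23 and the
  green-green one for D31, and every vertex of G is d_L for exactly one lozenge L of G.  With the
  uniform choice "d_L red, b_L blue" all red vertices would be sinks of the network below.
\<close>

fun dL :: "lozenge \<Rightarrow> vec3" where
  "dL (Loz r D12) = r"
| "dL (Loz r D23) = r + e23"
| "dL (Loz r D31) = r - e12"

fun bL :: "lozenge \<Rightarrow> vec3" where
  "bL (Loz r D12) = r + e12"
| "bL (Loz r D23) = r"
| "bL (Loz r D31) = r - e23"

fun aL :: "lozenge \<Rightarrow> vec3" where
  "aL (Loz r D12) = r - e23"
| "aL (Loz r D23) = r - e31"
| "aL (Loz r D31) = r"

fun cL :: "lozenge \<Rightarrow> vec3" where
  "cL (Loz r D12) = r - e31"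
| "cL (Loz r D23) = r - e12"
| "cL (Loz r D31) = r + e31"

definition corners :: "lozenge \<Rightarrow> vec3 set" where
  "corners L = {aL L, bL L, cL L, dL L}"

definition diagonals :: "lozenge \<Rightarrow> vec3 set set" where
  "diagonals L = {{aL L, cL L}, {bL L, dL L}}"

lemma lozenge_sides:
  assumes "L \<in> lozenges"
  shows "{{aL L, bL L}, {bL L, cL L}, {cL L, dL L}, {dL L, aL L}} \<subseteq> G_edges"
proof -
  obtain i j k e where L: "L = Loz (i, j, k) e"
    by (metis lozenge.exhaust prod_cases3)
  have "i + j + k = 0" and "(j - k) mod 3 = 0"
    using assms by (auto simp: lozenges_def P0_def L)
  then obtain m where m: "j = k + 3 * m"
    by (auto simp: mod_eq_0_iff_dvd dvd_def algebra_simps)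
  have i: "i = - 2 * k - 3 * m"
    using \<open>i + j + k = 0\<close> m by simp
  have edge: "{x, y} \<in> G_edges"
    if "x \<in> P0 \<and> color x \<noteq> 0 \<and> y - x \<in> {e12, e23, e31} \<or>
        y \<in> P0 \<and> color y \<noteq> 0 \<and> x - y \<in> {e12, e23, e31}" for x y
  proof -
    have *: "{x, y} \<in> G_edges"
      if h: "x \<in> P0" "color x \<noteq> 0" "y - x \<in> {e12, e23, e31}" for x y
    proof -
      have "{x, y} = {x, x + (y - x)}" by simp
      with h show ?thesis unfolding G_edges_def by blast
    qed
    from that show ?thesis
      using *[of x y] *[of y x] by (auto simp: insert_commute)
  qed
  show ?thesis
    unfolding L
    by (cases e; simp; intro conjI edge;
        auto simp: m i P0_def; presburger)
qed


section \<open>The region G(v,t)\<close>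

fun real3 :: "vec3 \<Rightarrow> real \<times> real \<times> real" where
  "real3 (i, j, k) = (real_of_int i, real_of_int j, real_of_int k)"

definition Delta :: "vec3 \<Rightarrow> nat \<Rightarrow> (real \<times> real \<times> real) set" where
  "Delta v t = convex hull
     {real3 v + real t *\<^sub>R real3 e12, real3 v + real t *\<^sub>R real3 e23, real3 v + real t *\<^sub>R real3 e31}"

definition Loz_in :: "vec3 \<Rightarrow> nat \<Rightarrow> lozenge set" where
  "Loz_in v t = {L \<in> lozenges. convex hull (real3 ` corners L) \<subseteq> Delta v t}"

definition Vert :: "vec3 \<Rightarrow> nat \<Rightarrow> vec3 set" where
  "Vert v t = (\<Union>L\<in>Loz_in v t. corners L)"

text \<open>The boundary vertices a_n, b_n, c_n, for n = 1, ..., 2t - 1.\<close>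

definition bda :: "vec3 \<Rightarrow> nat \<Rightarrow> nat \<Rightarrow> vec3" where
  "bda v t n = (let i = int (n div 2); t' = int t in
     if even n then v + (i, t' - 2 * i, i - t') else v + (i, t' - 1 - 2 * i, i - t' + 1))"

definition bdb :: "vec3 \<Rightarrow> nat \<Rightarrow> nat \<Rightarrow> vec3" where
  "bdb v t n = (let i = int (n div 2); t' = int t in
     if even n then v + (t' - 2 * i, i - t', i) else v + (t' - 1 - 2 * i, i - t' + 1, i))"

definition bdc :: "vec3 \<Rightarrow> nat \<Rightarrow> nat \<Rightarrow> vec3" where
  "bdc v t n = (let i = int (n div 2); t' = int t in
     if even n then v + (i - t', i, t' - 2 * i) else v + (i - t' + 1, i, t' - 1 - 2 * i))"

definition boundary :: "vec3 \<Rightarrow> nat \<Rightarrow> vec3 set" where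
  "boundary v t = (\<Union>n\<in>{1..2 * t - 1}. {bda v t n, bdb v t n, bdc v t n})"


section \<open>Rooted forests\<close>

text \<open>
  A graph with two-element edges is given by its set of edges.  A path is a nonempty repetition-free
  list of successively adjacent vertices.
\<close>

definition gpath :: "'v set set \<Rightarrow> 'v list \<Rightarrow> bool" where
  "gpath F p \<longleftrightarrow> p \<noteq> [] \<and> distinct p \<and> successively (\<lambda>u w. {u, w} \<in> F) p"

definition acyclic_graph :: "'v set set \<Rightarrow> bool" where
  "acyclic_graph F \<longleftrightarrow> (\<nexists>p. gpath F p \<and> 3 \<le> length p \<and> {last p, hd p} \<in> F)"

definition components :: "'v set \<Rightarrow> 'v set set \<Rightarrow> 'v set set" where
  "components V F = V // {(u, w). u \<in> V \<and> w \<in> V \<and> (\<exists>p. gpath F p \<and> hd p = u \<and> last p = w)}"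

definition degree :: "'v set set \<Rightarrow> 'v \<Rightarrow> nat" where
  "degree F u = card {e \<in> F. u \<in> e}"

text \<open>A forest is identified with its edge set, since its vertex set is always Vert v t.\<close>

definition forests :: "vec3 \<Rightarrow> nat \<Rightarrow> vec3 set set set" where
  "forests v t = {F. F \<subseteq> (\<Union>L\<in>Loz_in v t. diagonals L) \<and>
     (\<forall>L\<in>Loz_in v t. \<exists>!D. D \<in> diagonals L \<and> D \<in> F) \<and> acyclic_graph F}"

text \<open>A root choice is an (extensional) function assigning to each component its root.\<close>

type_synonym rforest = "vec3 set set \<times> (vec3 set \<Rightarrow> vec3)"

definition rooted_forests :: "vec3 \<Rightarrow> nat \<Rightarrow> rforest set" where
  "rooted_forests v t =
     (SIGMA F : forests v t. \<Pi>\<^sub>E C\<in>components (Vert v t) F. C \<inter> boundary v t)"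

text \<open>The edge {u, w} is oriented u -> w if the path from u to the root of its component starts
  with this edge.\<close>

definition oriented :: "vec3 \<Rightarrow> nat \<Rightarrow> rforest \<Rightarrow> vec3 \<Rightarrow> vec3 \<Rightarrow> bool" where
  "oriented v t R u w \<longleftrightarrow>
     (\<exists>C\<in>components (Vert v t) (fst R). \<exists>p. u \<in> C \<and> gpath (fst R) (u # w # p) \<and>
        last (u # w # p) = snd R C)"

definition s_exp :: "vec3 \<Rightarrow> nat \<Rightarrow> vec3 \<Rightarrow> int" where
  "s_exp v t u = (if u \<notin> boundary v t then 0
     else if u \<in> {bda v t 1, bdb v t 1, bdc v t 1} then 2 else 1)"

text \<open>
  The weights are Laurent monomials in the indeterminates x_u; they are evaluated at arbitrary
  elements x u of an arbitrary field, which are assumed to be nonzero where weights are compared.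
\<close>

definition wt_forest :: "(vec3 \<Rightarrow> 'a::field) \<Rightarrow> vec3 \<Rightarrow> nat \<Rightarrow> vec3 set set \<Rightarrow> 'a" where
  "wt_forest x v t F = (\<Prod>u\<in>Vert v t. x u powi (int (degree F u) - 2 + s_exp v t u))"


section \<open>The network and its boundary r-paths\<close>

datatype node = Pt vec3 | Center lozenge

type_synonym arc = "node \<times> node"

definition net :: "vec3 \<Rightarrow> nat \<Rightarrow> arc set" where
  "net v t = (\<Union>L\<in>Loz_in v t. {(Pt (aL L), Center L), (Pt (cL L), Center L),
     (Pt (bL L), Center L), (Center L, Pt (dL L))})"

definition alpha :: "(vec3 \<Rightarrow> 'a::field) \<Rightarrow> lozenge \<Rightarrow> 'a" where
  "alpha x L = x (aL L) * x (cL L) / (x (bL L) * x (dL L))"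

fun arc_wt :: "(vec3 \<Rightarrow> 'a::field) \<Rightarrow> arc \<Rightarrow> 'a" where
  "arc_wt x (Pt u, Center L) = (if u \<in> {aL L, cL L} then alpha x L else 1)"
| "arc_wt x _ = 1"

definition path_arcs :: "node list \<Rightarrow> arc set" where
  "path_arcs p = set (zip p (tl p))"

text \<open>
  A boundary path runs from a boundary vertex that is a source of the network (no arc enters it)
  to a boundary vertex.  The restriction to sources is needed: a path starting at a vertex d_L of
  the region, such as the two-arc path from c_2 to a_1 for t = 2, never occurs in the image of phi,
  because the vertex d_L would have two outgoing edges in the forest.  Paths have at least one arc, so that a tuple of vertex-disjoint paths can
  be recovered, up to order, from its set of arcs.
\<close>

definition boundary_path :: "vec3 \<Rightarrow> nat \<Rightarrow> node list \<Rightarrow> bool" where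
  "boundary_path v t p \<longleftrightarrow>
     2 \<le> length p \<and> distinct p \<and> path_arcs p \<subseteq> net v t \<and>
     hd p \<in> Pt ` boundary v t \<and> (\<forall>q. (q, hd p) \<notin> net v t) \<and>
     last p \<in> Pt ` boundary v t"

definition boundary_rpaths :: "vec3 \<Rightarrow> nat \<Rightarrow> nat \<Rightarrow> arc set set" where
  "boundary_rpaths v t r = {(\<Union>p\<in>set ps. path_arcs p) | ps.
     length ps = r \<and> (\<forall>p\<in>set ps. boundary_path v t p) \<and>
     (\<forall>i<r. \<forall>j<r. i \<noteq> j \<longrightarrow> set (ps ! i) \<inter> set (ps ! j) = {})}"

definition wt_arcs :: "(vec3 \<Rightarrow> 'a::field) \<Rightarrow> arc set \<Rightarrow> 'a" where
  "wt_arcs x E = (\<Prod>a\<in>E. arc_wt x a)"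


section \<open>The map phi and the factor W\<close>

definition phi :: "vec3 \<Rightarrow> nat \<Rightarrow> rforest \<Rightarrow> arc set" where
  "phi v t R = (\<Union>L\<in>Loz_in v t. \<Union>{{(Pt u, Center L), (Center L, Pt (dL L))} | u w.
     {u, w} \<in> diagonals L \<and> oriented v t R u w \<and> u \<noteq> dL L})"

definition W :: "(vec3 \<Rightarrow> 'a::field) \<Rightarrow> vec3 \<Rightarrow> nat \<Rightarrow> 'a" where
  "W x v t = (\<Prod>i\<in>{0..t - 1}. x (bda v t (2 * i + 1))) / (\<Prod>i\<in>{1..t - 1}. x (bda v t (2 * i)))"

end

(*
  Record a rooted forest or an r-path by the tail of the oriented diagonal of each lozenge L (the tail
  being d_L if the center of L is not visited).  On either side the admissible records are the injective
  choices of corners that miss only boundary vertices, and phi preserves them.  The one nontrivial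
  point is that such a choice, read as a partial function f on vertices, has no cycle.

  Suppose f Z = Z for a nonempty set Z of vertices.  The flow along the edges u -> f u, u in Z, is a
  circulation, hence the two ends of a diagonal differ in height by the flow along the other diagonal
  of its lozenge, for a height function that vanishes on the boundary.  Heights are nonzero somewhere
  next to Z and constant along f, because the other diagonal of the lozenge used by u carries no flow.
  So the set of vertices of nonzero height contains a nonempty set Z' with f Z' = Z', and the least
  j-coordinate on Z' exceeds the least one on Z.  This cannot be repeated forever.

  For the weights, every vertex is b_L and d_L for one lozenge of G each, and the lozenges outside the
  region account for the exponents s(u) and the factor W.
*)
theory Submission
  imports Defs
begin

section \<open>Paths in forests\<close>

text \<open>That \<open>f\<close> has no cycle does not follow from the acyclicity of the network: a
  tail \<open>dL L\<close> makes \<open>f\<close> run from \<open>dL L\<close> to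
  \<open>bL L\<close>, against the arcs, so no potential increases along \<open>f\<close>. The
  reason is planarity. The red-blue diagonals form a honeycomb, the green-green ones a triangular
  lattice, and these two graphs are planar duals, the two diagonals of a lozenge being a pair of
  dual edges. A circulation on either graph is the gradient of a potential on the vertices of the
  other, and the height function consists of both potentials. It acts as a winding number: its
  support is what the cycles enclose, and constancy along \<open>f\<close> says that an orbit of
  \<open>f\<close> cannot cross a cycle. In this way the enclosed region is available without the
  Jordan curve theorem. The heights are summed against the direction from \<open>bL L\<close> to
  \<open>dL L\<close>. As every vertex is \<open>dL L\<close> for one lozenge, half of the relations
  between heights and flow then serve as a recursive definition, and conservation of the flow yields
  the other half.\<close>

lemma gpath_Cons:
  "gpath F (u # p) \<longleftrightarrow> p = [] \<or> (u \<notin> set p \<and> {u, hd p} \<in> F \<and> gpath F p)"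
  by (cases p) (auto simp: gpath_def)

lemma gpath_rev: "gpath F (rev p) \<longleftrightarrow> gpath F p"
  by (simp add: gpath_def successively_rev insert_commute)

lemma gpath_append:
  "gpath F (p @ q) \<longleftrightarrow> (if p = [] then gpath F q else if q = [] then gpath F p else
     gpath F p \<and> gpath F q \<and> set p \<inter> set q = {} \<and> {last p, hd q} \<in> F)"
  by (auto simp: gpath_def successively_append_iff)

text \<open>Otherwise following \<open>p\<close> up to its first vertex on \<open>q\<close> and
  returning to \<open>u\<close> along \<open>q\<close> would close a cycle; distinct first steps
  give it at least three vertices.\<close>

lemma acyclic_hd_eq:
  assumes ac: "acyclic_graph F" and p: "gpath F (u # p)" and q: "gpath F (u # q)"
    and ne: "p \<noteq> []" "q \<noteq> []" and last: "last p = last q"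
  shows "hd p = hd q"
proof (rule ccontr)
  assume neq: "hd p \<noteq> hd q"
  have "\<exists>x\<in>set p. x \<in> set q" using ne last by (metis last_in_set)
  then obtain p1 x p2 where p12: "p = p1 @ x # p2" "x \<in> set q" "\<forall>y\<in>set p1. y \<notin> set q"
    using split_list_first_prop[of p "\<lambda>y. y \<in> set q"] by blast
  then obtain q1 q2 where q12: "q = q1 @ x # q2"
    by (metis split_list)
  have pre: "gpath F xs" if "gpath F (xs @ ys)" "xs \<noteq> []" for xs ys :: "'a list"
    using that by (auto simp: gpath_append split: if_splits)
  have px: "gpath F ((u # p1) @ [x])"
    using p pre[of "(u # p1) @ [x]" p2] by (simp add: p12)
  have qx: "gpath F ((u # q1) @ [x])"
    using q pre[of "(u # q1) @ [x]" q2] by (simp add: q12)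
  have "gpath F (((u # p1) @ [x]) @ rev q1)"
  proof (cases "q1 = []")
    case False
    then have "gpath F q1" "{last q1, x} \<in> F" "u \<notin> set q1" "x \<notin> set q1"
      using qx q by (auto simp: gpath_Cons gpath_append q12)
    moreover have "set p1 \<inter> set q1 = {}" using p12(3) by (auto simp: q12)
    ultimately show ?thesis
      using px False by (subst gpath_append) (auto simp: gpath_rev hd_rev insert_commute)
  qed (use px in simp)
  moreover have "{last (((u # p1) @ [x]) @ rev q1), u} \<in> F"
    using qx by (cases q1) (auto simp: gpath_Cons insert_commute)
  moreover have "3 \<le> length (((u # p1) @ [x]) @ rev q1)"
    using neq by (cases p1; cases q1) (auto simp: p12 q12)
  ultimately show False using ac unfolding acyclic_graph_def by (metis append_Cons list.sel(1))
qed

lemma acyclic_gpath_unique: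
  assumes "acyclic_graph F"
  shows "gpath F (u # p) \<Longrightarrow> gpath F (u # q) \<Longrightarrow> last (u # p) = last (u # q) \<Longrightarrow> p = q"
proof (induction p arbitrary: u q)
  case Nil
  then show ?case by (auto simp: gpath_Cons split: if_splits)
next
  case (Cons w p)
  have "q \<noteq> []"
    using Cons.prems by (auto simp: gpath_Cons split: if_splits)
  then obtain x q' where q: "q = x # q'" by (cases q) auto
  have "w = x"
    using acyclic_hd_eq[OF assms Cons.prems(1,2)] Cons.prems(3) q by simp
  moreover have "p = q'"
    using Cons.prems \<open>w = x\<close> by (intro Cons.IH[of w]) (auto simp: q gpath_Cons[of F u])
  ultimately show ?case by (simp add: q)
qed

lemma gpath_sub:
  assumes "gpath F p" "x \<in> set p"
  shows "\<exists>q. gpath F q \<and> hd q = hd p \<and> last q = x"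
proof -
  obtain p1 p2 where "p = p1 @ x # p2" using assms by (metis split_list)
  then have "p = (p1 @ [x]) @ p2" by simp
  then have "gpath F (p1 @ [x])" using assms(1) by (metis gpath_append append_is_Nil_conv not_Cons_self2 append_Nil2)
  moreover have "hd (p1 @ [x]) = hd p" using \<open>p = _ @ _ # _\<close> by (cases p1) auto
  ultimately show ?thesis by (intro exI[of _ "p1 @ [x]"]) auto
qed

text \<open>Joining two repetition-free paths may repeat vertices, so transitivity is not visible on
  paths; the closure turns components into classes of an equivalence relation.\<close>

lemma gpath_iff_rtrancl:
  "(\<exists>p. gpath F p \<and> hd p = u \<and> last p = w) \<longleftrightarrow> (u, w) \<in> {(a, b). {a, b} \<in> F}\<^sup>*"
proof
  assume "\<exists>p. gpath F p \<and> hd p = u \<and> last p = w"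
  then obtain p where "gpath F p" "hd p = u" "last p = w" by blast
  then show "(u, w) \<in> {(a, b). {a, b} \<in> F}\<^sup>*"
  proof (induction p arbitrary: u)
    case (Cons a p)
    then show ?case
      by (cases "p = []") (auto simp: gpath_Cons intro: converse_rtrancl_into_rtrancl)
  qed (simp add: gpath_def)
next
  assume "(u, w) \<in> {(a, b). {a, b} \<in> F}\<^sup>*"
  then show "\<exists>p. gpath F p \<and> hd p = u \<and> last p = w"
  proof (induction rule: rtrancl_induct)
    case base
    show ?case by (rule exI[of _ "[u]"]) (simp add: gpath_def)
  next
    case (step y z)
    then obtain p where p: "gpath F p" "hd p = u" "last p = y" by blast
    then have "p \<noteq> []" by (auto simp: gpath_def)
    show ?case
    proof (cases "z \<in> set p")
      case True
      then show ?thesis using gpath_sub[OF p(1)] p by auto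
    next
      case False
      have "gpath F (p @ [z])" using p step.hyps False \<open>p \<noteq> []\<close>
        by (auto simp: gpath_append gpath_Cons)
      then show ?thesis using p \<open>p \<noteq> []\<close> by (intro exI[of _ "p @ [z]"]) auto
    qed
  qed
qed

definition conn :: "'v set \<Rightarrow> 'v set set \<Rightarrow> ('v \<times> 'v) set" where
  "conn V F = {(u, w). u \<in> V \<and> w \<in> V \<and> (u, w) \<in> {(a, b). {a, b} \<in> F}\<^sup>*}"

lemma components_conn: "components V F = V // conn V F"
  by (simp add: components_def conn_def gpath_iff_rtrancl)

lemma equiv_conn: "equiv V (conn V F)"
proof -
  define R where "R = {(a, b). {a, b} \<in> F}"
  have "sym (R\<^sup>*)"
    by (intro sym_rtrancl) (auto simp: sym_def insert_commute R_def)
  moreover have "conn V F = R\<^sup>* \<inter> V \<times> V" by (auto simp: conn_def R_def)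
  ultimately show ?thesis
    by (auto intro!: equivI simp: refl_on_def sym_def trans_def intro: rtrancl_trans)
qed

lemma component_eq:
  assumes "C \<in> components V F" "u \<in> C" shows "C = conn V F `` {u}" "u \<in> V"
proof -
  show "C = conn V F `` {u}"
    using assms equiv_class_eq[OF equiv_conn] by (fastforce simp: components_conn quotient_def)
  show "u \<in> V" using assms by (auto simp: components_conn quotient_def conn_def)
qed

lemma conn_class_component: "u \<in> V \<Longrightarrow> conn V F `` {u} \<in> components V F"
  by (simp add: components_conn quotientI)

lemma conn_refl: "u \<in> V \<Longrightarrow> u \<in> conn V F `` {u}"
  by (simp add: conn_def)

section \<open>Orientation of a forest towards its roots\<close>

locale rooted_graph =
  fixes V :: "'v set" and F :: "'v set set" and \<rho> :: "'v set \<Rightarrow> 'v"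
  assumes ac: "acyclic_graph F" and FV: "\<And>u w. {u, w} \<in> F \<Longrightarrow> u \<in> V \<and> u \<noteq> w"
    and \<rho>: "\<And>C. C \<in> components V F \<Longrightarrow> \<rho> C \<in> C"
begin

definition root :: "'v \<Rightarrow> 'v" where "root u = \<rho> (conn V F `` {u})"

definition ori :: "'v \<Rightarrow> 'v \<Rightarrow> bool" where
  "ori u w \<longleftrightarrow> u \<in> V \<and> (\<exists>p. gpath F (u # w # p) \<and> last (u # w # p) = root u)"

lemma ori_alt:
  "(\<exists>C\<in>components V F. \<exists>p. u \<in> C \<and> gpath F (u # w # p) \<and> last (u # w # p) = \<rho> C) \<longleftrightarrow> ori u w"
  unfolding ori_def root_def
  using component_eq conn_class_component conn_refl by metis

lemma root_edge:
  assumes "{u, w} \<in> F" shows "root u = root w"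
proof -
  have "u \<in> V" "w \<in> V" using FV[of u w] FV[of w u] assms by (auto simp: insert_commute)
  then have "(u, w) \<in> conn V F" using assms by (auto simp: conn_def)
  then show ?thesis unfolding root_def using equiv_class_eq[OF equiv_conn] by metis
qed

lemma root_path:
  assumes "u \<in> V" obtains p where "gpath F (u # p)" "last (u # p) = root u"
proof -
  have "root u \<in> conn V F `` {u}"
    unfolding root_def using \<rho> conn_class_component assms by metis
  then obtain p where "gpath F p" "hd p = u" "last p = root u"
    unfolding conn_def gpath_iff_rtrancl[symmetric] by blast
  moreover from this have "p \<noteq> []" by (auto simp: gpath_def)
  ultimately show ?thesis using that by (metis list.collapse)
qed

lemma ori_unique: "ori u w \<Longrightarrow> ori u w' \<Longrightarrow> w = w'"
  unfolding ori_def using acyclic_gpath_unique[OF ac] by (metis list.inject)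

lemma ori_edge: "ori u w \<Longrightarrow> {u, w} \<in> F"
  by (auto simp: ori_def gpath_Cons)

lemma root_not_ori:
  assumes "u \<in> V" "root u = u" shows "\<not> ori u w"
  using acyclic_gpath_unique[OF ac, of u "[]"] assms by (auto simp: ori_def gpath_Cons split: if_splits)

lemma nonroot_ori:
  assumes "u \<in> V" "root u \<noteq> u" shows "\<exists>w. ori u w"
proof -
  obtain p where "gpath F (u # p)" "last (u # p) = root u" using root_path assms by blast
  then show ?thesis using assms unfolding ori_def by (cases p) (simp, blast)
qed

text \<open>The path from \<open>u\<close> to the root continues from \<open>w\<close>; if it were
  also the path from \<open>w\<close> through \<open>u\<close>, the vertex \<open>u\<close> would
  occur on it twice.\<close>

lemma ori_asym: assumes "ori u w" shows "\<not> ori w u"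
proof
  assume wu: "ori w u"
  obtain p where p: "gpath F (u # w # p)" "last (u # w # p) = root u" using assms by (auto simp: ori_def)
  obtain q where q: "gpath F (w # u # q)" "last (w # u # q) = root w" using wu by (auto simp: ori_def)
  have "root u = root w" using root_edge ori_edge assms by blast
  moreover have "gpath F (w # p)" using p by (auto simp: gpath_Cons[of _ u])
  ultimately have "p = u # q"
    using acyclic_gpath_unique[OF ac, of w p "u # q"] p q by simp
  then show False using p by (simp add: gpath_def)
qed

text \<open>If the path from \<open>u\<close> to the root meets \<open>w\<close>, then by uniqueness
  it does so in its first step. If it avoids \<open>w\<close>, the edge extends it to the path from
  \<open>w\<close>.\<close>

lemma edge_ori:
  assumes "{u, w} \<in> F" shows "ori u w \<or> ori w u"
proof (cases "ori u w")
  case False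
  have V: "u \<in> V" "w \<in> V" "u \<noteq> w" using FV[of u w] FV[of w u] assms by (auto simp: insert_commute)
  obtain p where p: "gpath F (u # p)" "last (u # p) = root u" using root_path V by blast
  have "w \<notin> set p"
  proof
    assume "w \<in> set p"
    then obtain p1 p2 where p12: "p = p1 @ w # p2" by (metis split_list)
    have "gpath F ((u # p1 @ [w]) @ p2)" using p by (simp add: p12)
    then have "gpath F (u # p1 @ [w])" by (simp only: gpath_append) (auto split: if_splits)
    moreover have "gpath F (u # [w])" using V assms by (auto simp: gpath_def)
    ultimately have "p1 @ [w] = [w]"
      by (rule acyclic_gpath_unique[OF ac]) simp
    then show False using p p12 False V(1) by (auto simp: ori_def)
  qed
  then have "gpath F (w # u # p)" using p assms V by (simp add: gpath_Cons[of _ w] insert_commute)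
  moreover have "last (w # u # p) = root w" using p(2) root_edge[OF assms] by simp
  ultimately show ?thesis using V unfolding ori_def by blast
qed simp

end

section \<open>Functional graphs\<close>

text \<open>The assumption \<open>exits\<close> is the absence of cycles in orbit form; the vertices
  of \<open>V - D\<close>, at which \<open>f\<close> stops, become the roots.\<close>

locale functional_graph =
  fixes V D :: "'v set" and f :: "'v \<Rightarrow> 'v"
  assumes DV: "D \<subseteq> V" and fV: "\<And>u. u \<in> D \<Longrightarrow> f u \<in> V"
    and exits: "\<And>u. u \<in> V \<Longrightarrow> \<exists>n. (f ^^ n) u \<notin> D"
begin

definition FE :: "'v set set" where "FE = {{u, f u} | u. u \<in> D}"

definition rk :: "'v \<Rightarrow> nat" where "rk u = (LEAST n. (f ^^ n) u \<notin> D)"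

definition rt :: "'v \<Rightarrow> 'v" where "rt u = (f ^^ rk u) u"

lemma rk_f: assumes "u \<in> D" shows "rk u = Suc (rk (f u))"
proof -
  obtain n where "(f ^^ n) u \<notin> D" using exits DV assms by blast
  then show ?thesis unfolding rk_def
    using Least_Suc[of "\<lambda>n. (f ^^ n) u \<notin> D" n] assms by (simp add: funpow_swap1)
qed

lemma rt_f: "u \<in> D \<Longrightarrow> rt (f u) = rt u"
  by (simp add: rt_def rk_f funpow_swap1)

lemma rt_root: "u \<notin> D \<Longrightarrow> rt u = u"
  unfolding rt_def rk_def by (subst Least_eq_0) auto

lemma rt_notin: "u \<in> V \<Longrightarrow> rt u \<in> V - D"
proof (induction "rk u" arbitrary: u rule: less_induct)
  case less
  then show ?case
    by (cases "u \<in> D") (use rk_f[of u] rt_f[of u] fV[of u] rt_root[of u] less.hyps[of "f u"] in auto)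
qed

lemma FE_edge: "{u, w} \<in> FE \<Longrightarrow> (u \<in> D \<and> w = f u) \<or> (w \<in> D \<and> u = f w)"
  by (auto simp: FE_def doubleton_eq_iff)

text \<open>An edge changes \<open>rk\<close> by exactly one, and the only neighbour of
  \<open>u\<close> of smaller rank is \<open>f u\<close>. So a vertex of maximal rank on a cycle
  cannot have two neighbours on it.\<close>

lemma acyclic_FE: "acyclic_graph FE"
  unfolding acyclic_graph_def
proof (intro notI, elim exE conjE)
  fix p assume p: "gpath FE p" "3 \<le> length p" "{last p, hd p} \<in> FE"
  obtain u where u: "u \<in> set p" "\<forall>x\<in>set p. rk x \<le> rk u"
    using ex_is_arg_min_if_finite[of "set p" "\<lambda>x. - int (rk x)"] p(2) by (fastforce simp: is_arg_min_linorder)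
  have key: "x = f u" if "{u, x} \<in> FE" "x \<in> set p" for x
    using FE_edge[OF that(1)] rk_f[of x] u(2) that(2) by fastforce
  obtain p1 p2 where p12: "p = p1 @ u # p2" using u(1) by (metis split_list)
  have d: "distinct p" using p by (simp add: gpath_def)
  have nxt: "p2 \<noteq> [] \<Longrightarrow> {u, hd p2} \<in> FE" and prv: "p1 \<noteq> [] \<Longrightarrow> {u, last p1} \<in> FE"
    using p(1) unfolding p12 by (auto simp: gpath_append gpath_Cons insert_commute split: if_splits)
  \<comment> \<open>The two neighbours of \<open>u\<close> on the cycle; for an end of the list
    \<open>p\<close>, one of them sits at the other end.\<close>
  define a where "a = (if p1 = [] then last p2 else last p1)"
  define b where "b = (if p2 = [] then hd p1 else hd p2)"
  have "a \<in> set p" "b \<in> set p" "{u, a} \<in> FE" "{u, b} \<in> FE"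
    using p nxt prv by (cases "p1 = []"; cases "p2 = []"; auto simp: a_def b_def p12 insert_commute)+

  then have "a = b" using key by metis
  moreover have "a \<noteq> b"
  proof (cases "p1 = []")
    case True
    then show ?thesis using p(2) d
      by (cases p2) (auto simp: a_def b_def p12)
  next
    case False
    then show ?thesis using p(2) d
      by (cases p1 rule: rev_cases; cases p2) (auto simp: a_def b_def p12 hd_append split: if_splits)
  qed
  ultimately show False by simp
qed

lemma rt_path:
  assumes "u \<in> V"
  shows "\<exists>p. gpath FE (u # p) \<and> last (u # p) = rt u \<and> (u \<in> D \<longrightarrow> p \<noteq> [] \<and> hd p = f u)
     \<and> (\<forall>x\<in>set p. rk x < rk u)"
  using assms
proof (induction "rk u" arbitrary: u rule: less_induct)
  case less
  show ?case
  proof (cases "u \<in> D")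
    case True
    then obtain p where p: "gpath FE (f u # p)" "last (f u # p) = rt (f u)" "\<forall>x\<in>set p. rk x < rk (f u)"
      using less.hyps[of "f u"] rk_f fV by auto
    have *: "\<forall>x\<in>set (f u # p). rk x < rk u" using p(3) rk_f[OF True] by auto
    then have "u \<notin> set (f u # p)" by blast
    then show ?thesis
      using p True rt_f * by (intro exI[of _ "f u # p"]) (auto simp: gpath_Cons[of _ u] FE_def)
  next
    case False
    then show ?thesis using rt_root by (intro exI[of _ "[]"]) (auto simp: gpath_def)
  qed
qed

lemma rt_conn: "(u, w) \<in> {(a, b). {a, b} \<in> FE}\<^sup>* \<Longrightarrow> rt u = rt w"
  by (induction rule: rtrancl_induct) (auto dest!: FE_edge simp: rt_f)

lemma rt_in_component:
  assumes "u \<in> V" shows "rt u \<in> conn V FE `` {u}"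
proof -
  obtain p where "gpath FE (u # p)" "last (u # p) = rt u" using rt_path assms by blast
  then have "(u, rt u) \<in> {(a, b). {a, b} \<in> FE}\<^sup>*"
    unfolding gpath_iff_rtrancl[symmetric] by (intro exI[of _ "u # p"]) auto
  then show ?thesis using assms rt_notin[of u] by (auto simp: conn_def)
qed

text \<open>All orbits in a component end at the same vertex, the only one outside \<open>D\<close>.
  The bounded lambda makes the choice extensional, as \<open>rooted_forests\<close>
  requires.\<close>

definition rchoice :: "'v set \<Rightarrow> 'v" where
  "rchoice = (\<lambda>C\<in>components V FE. THE s. s \<in> C \<and> s \<notin> D)"

lemma rchoice_eq:
  assumes C: "C \<in> components V FE" "u \<in> C" shows "rchoice C = rt u"
proof -
  have Ceq: "C = conn V FE `` {u}" "u \<in> V" using component_eq[OF C] by auto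
  have "(THE s. s \<in> C \<and> s \<notin> D) = rt u"
  proof (rule the_equality)
    show "rt u \<in> C \<and> rt u \<notin> D" using rt_in_component rt_notin Ceq by auto
    show "s = rt u" if "s \<in> C \<and> s \<notin> D" for s
      using that rt_conn[of u s] rt_root[of s] by (auto simp: Ceq conn_def)
  qed
  then show ?thesis using C by (simp add: rchoice_def)
qed

lemma rchoice_in: "C \<in> components V FE \<Longrightarrow> rchoice C \<in> C - D"
  by (metis DiffE DiffI component_eq conn_refl components_conn equiv_conn in_quotient_imp_non_empty
      ex_in_conv rchoice_eq rt_in_component rt_notin)

text \<open>A path that goes against \<open>f\<close> must continue to do so, because the one edge
  along \<open>f\<close> leads back to the vertex just left. Hence it never ends at a root.\<close>

lemma wrong_way_last:
  "gpath FE (u # w # p) \<Longrightarrow> w \<in> D \<Longrightarrow> f w = u \<Longrightarrow> last (w # p) \<in> D"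
proof (induction p arbitrary: u w)
  case (Cons x p)
  have "{w, x} \<in> FE" "x \<noteq> u" using Cons.prems by (auto simp: gpath_Cons)
  then have "x \<in> D" "f x = w" using FE_edge[of w x] Cons.prems by auto
  moreover have "gpath FE (w # x # p)" using Cons.prems by (auto simp: gpath_Cons[of _ u])
  ultimately show ?case using Cons.IH[of w x] by simp
qed simp

text \<open>A path to the root cannot begin against \<open>f\<close>, as it would end inside
  \<open>D\<close>; conversely the orbit of \<open>u\<close> is such a path. So the orientation by
  roots gives back \<open>f\<close>.\<close>

lemma oriented_iff:
  "(\<exists>C\<in>components V FE. \<exists>p. u \<in> C \<and> gpath FE (u # w # p) \<and> last (u # w # p) = rchoice C)
     \<longleftrightarrow> u \<in> D \<and> f u = w" (is "?L \<longleftrightarrow> ?R")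
proof
  assume ?L
  then obtain C p where C: "C \<in> components V FE" "u \<in> C" "gpath FE (u # w # p)" "last (u # w # p) = rchoice C"
    by blast
  have "last (w # p) \<notin> D" using C rchoice_in by simp
  moreover have "{u, w} \<in> FE" using C by (simp add: gpath_Cons)
  ultimately show ?R using wrong_way_last[OF C(3)] FE_edge by metis
next
  assume R: ?R
  then have u: "u \<in> V" using DV by blast
  obtain p where p: "gpath FE (u # p)" "last (u # p) = rt u" "p \<noteq> []" "hd p = f u"
    using rt_path[OF u] R by blast
  then obtain q where "p = w # q" using R by (cases p) auto
  then show ?L using p rchoice_eq[OF conn_class_component[OF u] conn_refl[OF u]] u
    by (intro bexI[of _ "conn V FE `` {u}"] exI[of _ q] conjI conn_refl conn_class_component) auto
qed

end

text \<open>The iterated images of \<open>S\<close> decrease, so they stabilise, and the stable set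
  is nonempty.\<close>

lemma finite_invariant_subset:
  assumes "finite S" "S \<noteq> {}" "f ` S \<subseteq> S"
  shows "\<exists>Z\<subseteq>S. Z \<noteq> {} \<and> f ` Z = Z"
  using assms
proof (induction S rule: finite_psubset_induct)
  case (psubset S)
  show ?case
  proof (cases "f ` S = S")
    case False
    then show ?thesis using psubset.IH[of "f ` S"] psubset.prems by (metis image_is_empty image_mono psubsetI subset_trans)
  qed (use psubset in auto)
qed

section \<open>Decomposing arc sets into paths\<close>

lemma path_arcs_Cons: "path_arcs (x # p) = (if p = [] then {} else insert (x, hd p) (path_arcs p))"
  by (cases p) (auto simp: path_arcs_def)

lemma path_arcs_in: "p \<noteq> [] \<Longrightarrow> y \<in> set p \<Longrightarrow> y = hd p \<or> (\<exists>x. (x, y) \<in> path_arcs p)"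
  by (induction p) (auto simp: path_arcs_Cons split: if_splits)

lemma path_arcs_out: "p \<noteq> [] \<Longrightarrow> y \<in> set p \<Longrightarrow> y = last p \<or> (\<exists>x. (y, x) \<in> path_arcs p)"
  by (induction p) (auto simp: path_arcs_Cons split: if_splits)

lemma path_arcs_set: "(x, y) \<in> path_arcs p \<Longrightarrow> x \<in> set p \<and> y \<in> set (tl p)"
  by (auto simp: path_arcs_def dest: set_zip_leftD set_zip_rightD)

lemma path_arcs_out_unique: "distinct p \<Longrightarrow> (x, y) \<in> path_arcs p \<Longrightarrow> (x, z) \<in> path_arcs p \<Longrightarrow> y = z"
  by (induction p) (auto simp: path_arcs_Cons split: if_splits dest: path_arcs_set)

lemma path_arcs_hd: "distinct p \<Longrightarrow> (y, hd p) \<notin> path_arcs p"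
  using path_arcs_set[of y "hd p" p] by (cases p) (auto simp: path_arcs_def)

lemma path_arcs_in_unique: "distinct p \<Longrightarrow> (x, y) \<in> path_arcs p \<Longrightarrow> (z, y) \<in> path_arcs p \<Longrightarrow> x = z"
  by (induction p) (auto simp: path_arcs_Cons path_arcs_hd path_arcs_def[of "[]"] split: if_splits)

abbreviation disjoint_lists :: "'n list list \<Rightarrow> bool" where
  "disjoint_lists \<equiv> sorted_wrt (\<lambda>p q. set p \<inter> set q = {})"

lemma disjoint_lists_nth:
  "disjoint_lists ps \<longleftrightarrow>
    (\<forall>i<length ps. \<forall>j<length ps. i \<noteq> j \<longrightarrow> set (ps ! i) \<inter> set (ps ! j) = {})"
  (is "?L \<longleftrightarrow> ?R")
proof
  assume L: ?L
  show ?R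
  proof (intro allI impI)
    fix i j assume "i < length ps" "j < length ps" "i \<noteq> j"
    then show "set (ps ! i) \<inter> set (ps ! j) = {}"
      using sorted_wrt_nth_less[OF L, of i j] sorted_wrt_nth_less[OF L, of j i] by fastforce
  qed
qed (auto simp: sorted_wrt_iff_nth_less)

lemma disjoint_lists_unique:
  "disjoint_lists ps \<Longrightarrow> p \<in> set ps \<Longrightarrow> q \<in> set ps \<Longrightarrow> x \<in> set p \<Longrightarrow> x \<in> set q \<Longrightarrow> p = q"
  unfolding disjoint_lists_nth in_set_conv_nth[of p ps] in_set_conv_nth[of q ps] by (metis IntI empty_iff)

text \<open>Remove an arc whose tail has least potential: nothing enters its tail. Its head is then
  the first vertex of one of the remaining paths, which gets the tail prepended, or lies on none of
  them, and the arc is a path of its own. The potential excludes closed circuits, and the conditions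
  on the ends make the paths maximal.\<close>

lemma arc_set_decomposition:
  fixes E :: "arc set" and pot :: "node \<Rightarrow> int"
  assumes "finite E"
    and "\<And>x y. (x, y) \<in> E \<Longrightarrow> pot x < pot y"
    and "\<And>x y z. (x, y) \<in> E \<Longrightarrow> (x, z) \<in> E \<Longrightarrow> y = z"
    and "\<And>x y z. (x, y) \<in> E \<Longrightarrow> (z, y) \<in> E \<Longrightarrow> x = z"
  shows "\<exists>ps. E = (\<Union>p\<in>set ps. path_arcs p) \<and> disjoint_lists ps \<and>
    (\<forall>p\<in>set ps. 2 \<le> length p \<and> distinct p \<and> (\<forall>q. (q, hd p) \<notin> E) \<and> (\<forall>q. (last p, q) \<notin> E))"
  using assms
proof (induction "card E" arbitrary: E)
  case 0
  then show ?case by (intro exI[of _ "[]"]) auto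
next
  case (Suc n)
  then have "E \<noteq> {}" by auto
  define pm where "pm = Min ((pot \<circ> fst) ` E)"
  have "pm \<in> (pot \<circ> fst) ` E" unfolding pm_def using Suc.prems(1) \<open>E \<noteq> {}\<close> by (intro Min_in) auto
  then obtain x y where xy: "(x, y) \<in> E" "pm = pot x" by auto
  have pm: "pot x \<le> pot a" if "(a, b) \<in> E" for a b
  proof -
    have "pm \<le> (pot \<circ> fst) (a, b)" unfolding pm_def using that Suc.prems(1) by (intro Min_le) (blast intro: imageI)+
    then show ?thesis using xy by simp
  qed
  have noin: "(a, x) \<notin> E" for a using pm[of a x] Suc.prems(2)[of a x] by fastforce
  define E' where "E' = E - {(x, y)}"
  have "n = card E'" using Suc xy by (simp add: E'_def)
  then have "\<exists>ps. E' = (\<Union>p\<in>set ps. path_arcs p) \<and> disjoint_lists ps \<and>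
    (\<forall>p\<in>set ps. 2 \<le> length p \<and> distinct p \<and> (\<forall>q. (q, hd p) \<notin> E') \<and> (\<forall>q. (last p, q) \<notin> E'))"
  proof (rule Suc.hyps(1))
    show "finite E'" using Suc.prems(1) by (simp add: E'_def)
    show "pot a < pot b" if "(a, b) \<in> E'" for a b using that Suc.prems(2) by (simp add: E'_def)
    show "b = c" if "(a, b) \<in> E'" "(a, c) \<in> E'" for a b c
      using that Suc.prems(3)[of a b c] by (simp add: E'_def)
    show "a = c" if "(a, b) \<in> E'" "(c, b) \<in> E'" for a b c
      using that Suc.prems(4)[of a b c] by (simp add: E'_def)
  qed
  then obtain ps where ps: "E' = (\<Union>p\<in>set ps. path_arcs p)" "disjoint_lists ps"
    "\<forall>p\<in>set ps. 2 \<le> length p \<and> distinct p \<and> (\<forall>q. (q, hd p) \<notin> E') \<and> (\<forall>q. (last p, q) \<notin> E')"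
    by blast
  have E: "E = insert (x, y) E'" using xy by (auto simp: E'_def)
  \<comment> \<open>Since paths have at least two vertices, each vertex of a path lies on an arc of
    \<open>E'\<close>. No other arc of \<open>E\<close> meets \<open>x\<close>, so \<open>x\<close>
    is on none of the paths.\<close>
  have touched: "\<exists>b. (a, b) \<in> E' \<or> (b, a) \<in> E'" if "p \<in> set ps" "a \<in> set p" for p a
  proof -
    have "2 \<le> length p" using that ps(3) by blast
    then obtain u w q where "p = u # w # q" by (cases p; cases "tl p") auto
    then have "(u, w) \<in> path_arcs p" "u = hd p" "p \<noteq> []" by (simp_all add: path_arcs_Cons)
    moreover from this have "a = u \<or> (\<exists>b. (b, a) \<in> path_arcs p)"
      using path_arcs_in[of p a] that by blast
    moreover have "path_arcs p \<subseteq> E'" using ps(1) that by blast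
    ultimately show ?thesis by blast
  qed
  have xnot: "x \<notin> set p" if "p \<in> set ps" for p
    using touched[OF that] noin Suc.prems(3)[OF xy(1)] by (auto simp: E'_def)
  have "x \<noteq> y" using Suc.prems(2)[OF xy(1)] by auto
  have yin: "(a, y) \<notin> E'" for a using Suc.prems(4)[OF xy(1)] by (auto simp: E'_def)
  show ?case
  proof (cases "\<exists>p\<in>set ps. y \<in> set p")
    case True
    then obtain p where p: "p \<in> set ps" "y \<in> set p" by blast
    have "p \<noteq> []" using p by auto
    \<comment> \<open>At any other place of \<open>p\<close> the vertex \<open>y\<close> would have
      a second entering arc besides \<open>(x, y)\<close>.\<close>
    have hdp: "hd p = y" using path_arcs_in[OF \<open>p \<noteq> []\<close> p(2)] yin p(1) ps(1) by blast
    obtain l r where lr: "ps = l @ p # r" using p by (metis split_list)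
    define qs where "qs = l @ (x # p) # r"
    have "E = (\<Union>p\<in>set qs. path_arcs p)"
      using \<open>p \<noteq> []\<close> hdp by (auto simp: E ps(1) qs_def lr path_arcs_Cons)
    moreover have "disjoint_lists qs"
      using ps(2) xnot by (auto simp: qs_def lr sorted_wrt_append)
    moreover have "2 \<le> length q \<and> distinct q \<and> (\<forall>z. (z, hd q) \<notin> E) \<and> (\<forall>z. (last q, z) \<notin> E)"
      if "q \<in> set qs" for q
    proof (cases "q = x # p")
      case True
      then show ?thesis using p ps(3) noin xnot[OF p(1)] \<open>p \<noteq> []\<close> by (auto simp: E)
    next
      case False
      then have "q \<in> set ps" using that by (auto simp: qs_def lr)
      moreover have "y \<noteq> hd q"
      proof
        assume "y = hd q"
        moreover have "q \<noteq> []" using \<open>q \<in> set ps\<close> ps(3) by fastforce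
        ultimately have "y \<in> set q" by simp
        then have "q = p" using disjoint_lists_unique[OF ps(2)] p \<open>q \<in> set ps\<close> by blast
        then show False using that ps(2) \<open>y \<in> set q\<close> False by (auto simp: qs_def lr sorted_wrt_append)
      qed
      moreover have "last q \<noteq> x" using xnot[OF \<open>q \<in> set ps\<close>] ps(3) \<open>q \<in> set ps\<close>
        by (metis last_in_set list.size(3) not_numeral_le_zero)
      ultimately show ?thesis using ps(3) by (auto simp: E)
    qed
    ultimately show ?thesis by (intro exI[of _ qs]) blast
  next
    case False
    define qs where "qs = [x, y] # ps"
    have "E = (\<Union>p\<in>set qs. path_arcs p)"
      by (auto simp: E ps(1) qs_def path_arcs_Cons)
    moreover have "disjoint_lists qs"
      using ps(2) xnot False by (auto simp: qs_def)
    moreover have "2 \<le> length q \<and> distinct q \<and> (\<forall>z. (z, hd q) \<notin> E) \<and> (\<forall>z. (last q, z) \<notin> E)"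
      if "q \<in> set qs" for q
    proof (cases "q \<in> set ps")
      case True
      then have "q \<noteq> []" using ps(3) by fastforce
      then have "hd q \<in> set q" "last q \<in> set q" by simp_all
      then have "hd q \<noteq> y" "last q \<noteq> x" using True False xnot by blast+
      then show ?thesis using ps(3) True by (auto simp: E)
    next
      case q: False
      then have q': "q = [x, y]" using that by (simp add: qs_def)
      have "(y, z) \<notin> E" for z
      proof
        assume "(y, z) \<in> E"
        then have "(y, z) \<in> E'" using \<open>x \<noteq> y\<close> by (auto simp: E)
        then show False using False ps(1) path_arcs_set by fastforce
      qed
      then show ?thesis using noin \<open>x \<noteq> y\<close> by (auto simp: q')
    qed
    ultimately show ?thesis by (intro exI[of _ qs]) blast
  qed
qed

section \<open>Barycentric coordinates and the lozenges of the region\<close>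

text \<open>Barycentric coordinates up to scale: they sum to 0, and each takes the value -2 on one
  of \<open>e12\<close>, \<open>e23\<close>, \<open>e31\<close> and 1 on the other two.\<close>

fun crdA :: "vec3 \<Rightarrow> int" where "crdA (i, j, k) = i - k"
fun crdB :: "vec3 \<Rightarrow> int" where "crdB (i, j, k) = k - j"
fun crdC :: "vec3 \<Rightarrow> int" where "crdC (i, j, k) = j - i"

lemma crd_add [simp]:
  "crdA (u + w) = crdA u + crdA w" "crdB (u + w) = crdB u + crdB w" "crdC (u + w) = crdC u + crdC w"
  by (cases u; cases w; simp)+

lemma crd_diff [simp]:
  "crdA (u - w) = crdA u - crdA w" "crdB (u - w) = crdB u - crdB w" "crdC (u - w) = crdC u - crdC w"
  by (cases u; cases w; simp)+

lemma crdC_eq: "crdC u = - crdA u - crdB u"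
  by (cases u) simp

lemma color_crdB: "color u = (- crdB u) mod 3"
  by (cases u) simp

text \<open>On \<open>P0\<close> the coordinates agree modulo 3, so the color of a vertex determines
  the residues of all of them.\<close>

lemma crdA_mod: "u \<in> P0 \<Longrightarrow> 3 dvd (crdA u - crdB u)"
  by (cases u) (simp add: P0_def; presburger)

lemma P0_add: "u \<in> P0 \<Longrightarrow> w \<in> P0 \<Longrightarrow> u + w \<in> P0" and P0_diff: "u \<in> P0 \<Longrightarrow> w \<in> P0 \<Longrightarrow> u - w \<in> P0"
  by (auto simp: P0_def)

lemma P0_e [simp]: "e12 \<in> P0" "e23 \<in> P0" "e31 \<in> P0"
  by (simp_all add: P0_def)

lemma P0_steps [simp]:
  "u \<in> P0 \<Longrightarrow> u + e12 \<in> P0" "u \<in> P0 \<Longrightarrow> u + e23 \<in> P0" "u \<in> P0 \<Longrightarrow> u + e31 \<in> P0"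
  "u \<in> P0 \<Longrightarrow> u - e12 \<in> P0" "u \<in> P0 \<Longrightarrow> u - e23 \<in> P0" "u \<in> P0 \<Longrightarrow> u - e31 \<in> P0"
  by (simp_all only: P0_add P0_diff P0_e)

section \<open>Centers of lozenges and opposite corners\<close>

fun evec :: "dir \<Rightarrow> vec3" where "evec D12 = e12" | "evec D23 = e23" | "evec D31 = e31"

text \<open>Twice the center of the lozenge, which keeps it integral. Both diagonals are bisected
  there, so \<open>ctr L - u\<close> is the corner opposite to \<open>u\<close>.\<close>

definition ctr :: "lozenge \<Rightarrow> vec3" where "ctr L = red L + red L + evec (rbdir L)"

lemma ctr_ac: "aL L + cL L = ctr L" and ctr_bd: "bL L + dL L = ctr L"
  by (cases L; cases "rbdir L"; cases "red L"; simp add: ctr_def)+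

text \<open>The parities of the entries of \<open>ctr L\<close> reveal the direction, since
  \<open>e12\<close>, \<open>e23\<close>, \<open>e31\<close> differ modulo 2; the red vertex is then
  determined.\<close>

lemma ctr_inj: "ctr L = ctr M \<Longrightarrow> L = M"
proof -
  assume eq: "ctr L = ctr M"
  obtain i j k e i' j' k' e' where LM: "L = Loz (i, j, k) e" "M = Loz (i', j', k') e'"
    by (metis lozenge.exhaust prod_cases3)
  show "L = M" using eq unfolding LM by (cases e; cases e'; simp add: ctr_def; presburger)
qed

lemma corners_neq:
  "aL L \<noteq> bL L" "aL L \<noteq> cL L" "aL L \<noteq> dL L" "bL L \<noteq> cL L" "bL L \<noteq> dL L" "cL L \<noteq> dL L"
  by (cases L; cases "rbdir L"; cases "red L"; simp)+

lemma diagonal_sum: "{p, q} \<in> diagonals L \<Longrightarrow> p + q = ctr L"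
  using ctr_ac[of L] ctr_bd[of L] by (auto simp: diagonals_def doubleton_eq_iff add.commute)

lemma diagonal_unique: "{p, q} \<in> diagonals L \<Longrightarrow> {p, q} \<in> diagonals M \<Longrightarrow> L = M"
  using diagonal_sum ctr_inj by metis

lemma ctr_minus: "ctr L - aL L = cL L" "ctr L - cL L = aL L" "ctr L - bL L = dL L" "ctr L - dL L = bL L"
  using ctr_ac[of L] ctr_bd[of L] by (metis add_diff_cancel_left' add_diff_cancel_right')+

lemma corner_cases:
  assumes "u \<in> corners L"
  obtains "u = aL L" | "u = bL L" | "u = cL L" | "u = dL L"
  using assms unfolding corners_def by blast

lemma corner_diagonal: "u \<in> corners L \<Longrightarrow> {u, ctr L - u} \<in> diagonals L"
  by (erule corner_cases) (simp_all add: ctr_minus diagonals_def insert_commute)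

lemma opp_corner: "u \<in> corners L \<Longrightarrow> ctr L - u \<in> corners L"
  by (erule corner_cases) (simp_all add: ctr_minus corners_def)

lemma opp_neq: "u \<in> corners L \<Longrightarrow> ctr L - u \<noteq> u"
  using corners_neq[of L] by (metis corner_cases ctr_minus)

lemma diagonal_corner: "{p, q} \<in> diagonals L \<Longrightarrow> p \<in> corners L \<and> q \<in> corners L"
  by (auto simp: corners_def diagonals_def doubleton_eq_iff)

section \<open>The one lozenge in which a given vertex is \<open>d_L\<close>, and the one in which
  it is \<open>b_L\<close>\<close>

definition lozD :: "vec3 \<Rightarrow> lozenge" where
  "lozD u = (if color u = 0 then Loz u D12 else if color u = 1 then Loz (u + e12) D31
     else Loz (u - e23) D23)"

definition lozB :: "vec3 \<Rightarrow> lozenge" where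
  "lozB u = (if color u = 0 then Loz u D23 else if color u = 1 then Loz (u + e23) D31
     else Loz (u - e12) D12)"

lemma color_le_2: "color u \<noteq> 0 \<Longrightarrow> color u \<noteq> 1 \<Longrightarrow> color u = 2"
  unfolding color_crdB by presburger

lemma color_cases [case_names red green blue]:
  "(color p = 0 \<Longrightarrow> P) \<Longrightarrow> (color p = 1 \<Longrightarrow> P) \<Longrightarrow> (color p = 2 \<Longrightarrow> P) \<Longrightarrow> P"
  using color_le_2 by blast

lemma lozD: "u \<in> P0 \<Longrightarrow> lozD u \<in> lozenges \<and> dL (lozD u) = u"
  using color_le_2[of u]
  by (cases u) (auto simp: lozD_def lozenges_def P0_def; presburger)

lemma lozB: "u \<in> P0 \<Longrightarrow> lozB u \<in> lozenges \<and> bL (lozB u) = u"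
  using color_le_2[of u]
  by (cases u) (auto simp: lozB_def lozenges_def P0_def; presburger)

lemma color_steps:
  "color r = 0 \<Longrightarrow> color (r + e12) = 2" "color r = 0 \<Longrightarrow> color (r + e23) = 2"
  "color r = 0 \<Longrightarrow> color (r + e31) = 2" "color r = 0 \<Longrightarrow> color (r - e12) = 1"
  "color r = 0 \<Longrightarrow> color (r - e23) = 1" "color r = 0 \<Longrightarrow> color (r - e31) = 1"
  unfolding color_crdB by (simp; presburger)+

lemma lozD_dL: "L \<in> lozenges \<Longrightarrow> lozD (dL L) = L"
  by (cases L; cases "rbdir L") (simp_all add: lozD_def lozenges_def color_steps)

lemma lozB_bL: "L \<in> lozenges \<Longrightarrow> lozB (bL L) = L"
  by (cases L; cases "rbdir L") (simp_all add: lozB_def lozenges_def color_steps)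

lemma corners_P0: "L \<in> lozenges \<Longrightarrow> corners L \<subseteq> P0"
  by (cases L; cases "rbdir L") (auto simp: lozenges_def corners_def)

section \<open>The triangle in coordinates\<close>

locale region =
  fixes v :: vec3 and t :: nat
  assumes vP0: "v \<in> P0" and t2: "2 \<le> t" and colv: "(int t + 1) mod 3 = color v"
begin

definition hA :: "vec3 \<Rightarrow> int" where "hA u = crdA u - crdA v"
definition hB :: "vec3 \<Rightarrow> int" where "hB u = crdB u - crdB v"
definition hC :: "vec3 \<Rightarrow> int" where "hC u = crdC u - crdC v"

definition inside :: "vec3 \<Rightarrow> bool" where
  "inside u \<longleftrightarrow> hA u \<le> int t \<and> hB u \<le> int t \<and> hC u \<le> int t"

lemma abc_add [simp]:
  "hA (u + w) = hA u + crdA w" "hB (u + w) = hB u + crdB w" "hC (u + w) = hC u + crdC w"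
  "hA (u - w) = hA u - crdA w" "hB (u - w) = hB u - crdB w" "hC (u - w) = hC u - crdC w"
  by (simp_all add: hA_def hB_def hC_def)

lemma hC_eq: "hC u = - hA u - hB u"
  by (simp add: hA_def hB_def hC_def crdC_eq)

text \<open>The condition linking \<open>t\<close> and \<open>color v\<close> enters here: modulo 3
  the coordinates of a red, green or blue vertex are \<open>t - 2\<close>, \<open>t\<close> or
  \<open>t - 1\<close>. All bounds below come from rounding an inequality to the residue of the
  color.\<close>

lemma residues:
  assumes "u \<in> P0"
  obtains m n where "hA u = int t + 1 - color u + 3 * m" "hB u = int t + 1 - color u + 3 * n"
proof -
  have "3 dvd (hB u - (int t + 1 - color u))"
    using colv unfolding hB_def color_crdB by presburger
  moreover have "3 dvd (hA u - hB u)" unfolding hA_def hB_def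
    using crdA_mod[OF assms] crdA_mod[OF vP0] by presburger
  ultimately obtain m n where "hB u - (int t + 1 - color u) = 3 * m" "hA u - hB u = 3 * n"
    unfolding dvd_def by blast
  then show ?thesis by (intro that[of "m + n" m]) simp_all
qed

lemma real3_Delta:
  assumes "p \<in> P0" shows "real3 p \<in> Delta v t \<longleftrightarrow> inside p"
proof -
  obtain i j k x y z where p: "p = (i, j, k)" and v: "v = (x, y, z)" by (metis prod_cases3)
  have s: "k = - i - j" "z = - x - y" using assms vP0 by (auto simp: p v P0_def)
  have tpos: "real t > 0" using t2 by simp
  show ?thesis
  proof
    assume "real3 p \<in> Delta v t"
    then obtain \<alpha> \<beta> \<gamma> where h: "0 \<le> \<alpha>" "0 \<le> \<beta>" "0 \<le> \<gamma>" "\<alpha> + \<beta> + \<gamma> = 1"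
      "real3 p = \<alpha> *\<^sub>R (real3 v + real t *\<^sub>R real3 e12) + \<beta> *\<^sub>R (real3 v + real t *\<^sub>R real3 e23)
        + \<gamma> *\<^sub>R (real3 v + real t *\<^sub>R real3 e31)"
      unfolding Delta_def convex_hull_3 by blast
    have \<alpha>: "\<alpha> = 1 - \<beta> - \<gamma>" using h(4) by simp
    have 1: "real_of_int i = x + real t * (\<alpha> - \<gamma>)" "real_of_int j = y + real t * (\<beta> - \<alpha>)"
      using h(5) by (auto simp: p v \<alpha> algebra_simps)
    have "real_of_int (hA p) = real t - 3 * (real t * \<gamma>)" "real_of_int (hB p) = real t - 3 * (real t * \<beta>)"
      "real_of_int (hC p) = real t - 3 * (real t * \<alpha>)"
      using 1 unfolding hA_def hB_def hC_def by (auto simp: p v s \<alpha> algebra_simps)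
    then have "real_of_int (hA p) \<le> real t" "real_of_int (hB p) \<le> real t" "real_of_int (hC p) \<le> real t"
      using h tpos by auto
    then show "inside p" by (simp add: inside_def)
  next
    assume ins: "inside p"
    \<comment> \<open>The weight of a corner is the scaled distance from the opposite side; for
      instance the corner \<open>v + t e12\<close> is opposite to the side \<open>hC = t\<close> and
      has \<open>hC = - 2 * t\<close>.\<close>
    define \<alpha> \<beta> \<gamma> where "\<alpha> = (t - hC p) / (3 * real t)" and "\<beta> = (t - hB p) / (3 * real t)"
      and "\<gamma> = (t - hA p) / (3 * real t)"
    note abg = \<alpha>_def \<beta>_def \<gamma>_def
    have "0 \<le> \<alpha>" "0 \<le> \<beta>" "0 \<le> \<gamma>" using ins by (auto simp: abg inside_def)
    moreover have "\<alpha> + \<beta> + \<gamma> = 1"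
      using tpos by (simp add: abg hC_eq divide_simps)
    moreover have "real3 p = \<alpha> *\<^sub>R (real3 v + real t *\<^sub>R real3 e12) + \<beta> *\<^sub>R (real3 v + real t *\<^sub>R real3 e23)
        + \<gamma> *\<^sub>R (real3 v + real t *\<^sub>R real3 e31)"
    proof -
      have T: "real t * \<alpha> = (t - hC p) / 3" "real t * \<beta> = (t - hB p) / 3" "real t * \<gamma> = (t - hA p) / 3"
        using tpos by (simp_all add: abg)
      have diffs: "real t * \<alpha> - real t * \<gamma> = i - x" "real t * \<beta> - real t * \<alpha> = j - y"
        "real t * \<gamma> - real t * \<beta> = k - z"
        unfolding T hA_def hB_def hC_def by (simp_all add: p v s field_simps)
      have "\<alpha> * (x + real t) + \<beta> * x + \<gamma> * (x - real t) = (\<alpha> + \<beta> + \<gamma>) * x + (real t * \<alpha> - real t * \<gamma>)"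
        "\<alpha> * (y - real t) + \<beta> * (y + real t) + \<gamma> * y = (\<alpha> + \<beta> + \<gamma>) * y + (real t * \<beta> - real t * \<alpha>)"
        "\<alpha> * z + \<beta> * (z - real t) + \<gamma> * (z + real t) = (\<alpha> + \<beta> + \<gamma>) * z + (real t * \<gamma> - real t * \<beta>)"
        by (simp_all add: algebra_simps)
      then have "\<alpha> * (x + real t) + \<beta> * x + \<gamma> * (x - real t) = i"
        "\<alpha> * (y - real t) + \<beta> * (y + real t) + \<gamma> * y = j"
        "\<alpha> * z + \<beta> * (z - real t) + \<gamma> * (z + real t) = k"
        unfolding \<open>\<alpha> + \<beta> + \<gamma> = 1\<close> diffs by simp_all
      then show ?thesis by (simp add: p v)
    qed
    ultimately show "real3 p \<in> Delta v t"
      unfolding Delta_def convex_hull_3 by blast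
  qed
qed

lemma Loz_in_corners: "L \<in> Loz_in v t \<longleftrightarrow> L \<in> lozenges \<and> (\<forall>p\<in>corners L. inside p)"
proof -
  have "convex (Delta v t)" by (simp add: Delta_def)
  then have "convex hull (real3 ` corners L) \<subseteq> Delta v t \<longleftrightarrow> real3 ` corners L \<subseteq> Delta v t"
    by (metis hull_subset order_trans subset_hull)
  moreover have "real3 p \<in> Delta v t \<longleftrightarrow> inside p" if "L \<in> lozenges" "p \<in> corners L" for p
    using that corners_P0 real3_Delta by blast
  ultimately show ?thesis unfolding Loz_in_def by blast
qed

lemma inside_red:
  assumes "r \<in> P0" "color r = 0"
  shows "inside r \<longleftrightarrow> hA r \<le> int t - 2 \<and> hB r \<le> int t - 2 \<and> hC r \<le> int t - 2"
  by (rule residues[OF assms(1)]) (use assms(2) in \<open>simp add: inside_def hC_eq; presburger\<close>)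

lemma inside_blue:
  assumes "r \<in> P0" "color r = 2"
  shows "inside r \<longleftrightarrow> hA r \<le> int t - 1 \<and> hB r \<le> int t - 1 \<and> hC r \<le> int t - 1"
  by (rule residues[OF assms(1)]) (use assms(2) in \<open>simp add: inside_def hC_eq; presburger\<close>)

lemma green_less:
  assumes "u \<in> P0" "color u = 1"
  shows "hA u < int t \<longleftrightarrow> hA u \<le> int t - 3" "hB u < int t \<longleftrightarrow> hB u \<le> int t - 3" "hC u < int t \<longleftrightarrow> hC u \<le> int t - 3"
  by (rule residues[OF assms(1)]; use assms(2) in \<open>simp add: hC_eq; presburger\<close>)+

lemma blue_less:
  assumes "u \<in> P0" "color u = 2"
  shows "hA u < int t - 1 \<longleftrightarrow> hA u \<le> int t - 4" "hB u < int t - 1 \<longleftrightarrow> hB u \<le> int t - 4" "hC u < int t - 1 \<longleftrightarrow> hC u \<le> int t - 4"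
  by (rule residues[OF assms(1)]; use assms(2) in \<open>simp add: hC_eq; presburger\<close>)+

text \<open>By its residue a red vertex inside the triangle keeps distance 2 from every side, and a
  coordinate grows by at most 2 on the way to another corner of the lozenge.\<close>

lemma Loz_in_iff: "L \<in> Loz_in v t \<longleftrightarrow> red L \<in> P0 \<and> color (red L) = 0 \<and> inside (red L)"
proof (cases "L \<in> lozenges")
  case True
  then have r: "red L \<in> P0" "color (red L) = 0" by (auto simp: lozenges_def)
  have "(\<forall>p\<in>corners L. inside p) \<longleftrightarrow> inside (red L)"
  proof
    show "\<forall>p\<in>corners L. inside p \<Longrightarrow> inside (red L)"
      by (cases L; cases "rbdir L") (auto simp: corners_def)
    show "inside (red L) \<Longrightarrow> \<forall>p\<in>corners L. inside p"
      unfolding inside_red[OF r] by (cases L; cases "rbdir L") (auto simp: corners_def inside_def)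
  qed
  then show ?thesis using True r by (simp add: Loz_in_corners)
qed (auto simp: Loz_in_def lozenges_def)

lemma Loz_in_lozenges: "L \<in> Loz_in v t \<Longrightarrow> L \<in> lozenges"
  by (simp add: Loz_in_def)

lemma Vert_inside: "u \<in> Vert v t \<Longrightarrow> u \<in> P0 \<and> inside u"
  using corners_P0 by (fastforce simp: Vert_def Loz_in_corners)

lemma corner_Vert: "L \<in> Loz_in v t \<Longrightarrow> p \<in> corners L \<Longrightarrow> p \<in> Vert v t"
  by (auto simp: Vert_def)

lemma dL_Loz_in: "u \<in> P0 \<Longrightarrow> u \<in> dL ` Loz_in v t \<longleftrightarrow> lozD u \<in> Loz_in v t"
  using lozD lozD_dL Loz_in_lozenges by (metis image_eqI imageE)

lemma bL_Loz_in: "u \<in> P0 \<Longrightarrow> u \<in> bL ` Loz_in v t \<longleftrightarrow> lozB u \<in> Loz_in v t"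
  using lozB lozB_bL Loz_in_lozenges by (metis image_eqI imageE)

text \<open>From the red vertex of a lozenge to a green corner only one coordinate grows, so only
  one can reach \<open>t\<close>. This excludes the three corners of the triangle, which are green
  lattice points.\<close>

lemma Vert_green:
  assumes "u \<in> Vert v t" "color u = 1"
  shows "\<not> (hA u = int t \<and> hB u = int t)" "\<not> (hA u = int t \<and> hC u = int t)" "\<not> (hB u = int t \<and> hC u = int t)"
proof -
  obtain L where L: "L \<in> Loz_in v t" "u \<in> corners L" using assms by (auto simp: Vert_def)
  have r: "red L \<in> P0" "color (red L) = 0" and i: "inside (red L)" using L(1) by (auto simp: Loz_in_iff)
  have "u \<in> {red L - e12, red L - e23, red L - e31}"
    using L(2) r(2) assms(2) by (cases L; cases "rbdir L"; cases "red L") (auto simp: corners_def; presburger)+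
  then show "\<not> (hA u = int t \<and> hB u = int t)" "\<not> (hA u = int t \<and> hC u = int t)" "\<not> (hB u = int t \<and> hC u = int t)"
    using i unfolding inside_red[OF r] by auto
qed

text \<open>The red vertex of \<open>lozD u\<close> is \<open>u\<close>, \<open>u + e12\<close> or
  \<open>u - e23\<close> according to color. From a green vertex it can leave the triangle only
  across the sides A and B, from a blue one only across B. The exceptions are the sources of the
  network.\<close>

lemma dL_image:
  assumes u: "u \<in> Vert v t"
  shows "u \<in> dL ` Loz_in v t \<longleftrightarrow> \<not> (color u = 1 \<and> (hA u = int t \<or> hB u = int t) \<or> color u = 2 \<and> hB u = int t - 1)"
proof -
  have P: "u \<in> P0" "inside u" using Vert_inside[OF u] by auto
  have "lozD u \<in> lozenges" using lozD[OF P(1)] by blast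
  then have r: "red (lozD u) \<in> P0" "color (red (lozD u)) = 0" by (auto simp: lozenges_def)
  have *: "lozD u \<in> Loz_in v t \<longleftrightarrow> inside (red (lozD u))" using r by (simp add: Loz_in_iff)
  consider "color u = 0" | "color u = 1" | "color u = 2" using color_le_2 by blast
  then show ?thesis
  proof cases
    case 1
    then show ?thesis using P unfolding dL_Loz_in[OF P(1)] * by (simp add: lozD_def)
  next
    case 2
    then show ?thesis using P green_less[OF P(1) 2] hC_eq[of u]
      unfolding dL_Loz_in[OF P(1)] * by (simp add: lozD_def inside_def; linarith)
  next
    case 3
    then show ?thesis using P blue_less[OF P(1) 3] hC_eq[of u] inside_blue[OF P(1) 3]
      unfolding dL_Loz_in[OF P(1)] * by (simp add: lozD_def inside_def; linarith)
  qed
qed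

text \<open>The mirror image of \<open>dL_image\<close>, with the sides B and C interchanged: the
  red vertices are now \<open>u\<close>, \<open>u + e23\<close> and \<open>u - e12\<close>.\<close>

lemma bL_image:
  assumes u: "u \<in> Vert v t"
  shows "u \<in> bL ` Loz_in v t \<longleftrightarrow> \<not> (color u = 1 \<and> (hA u = int t \<or> hC u = int t) \<or> color u = 2 \<and> hC u = int t - 1)"
proof -
  have P: "u \<in> P0" "inside u" using Vert_inside[OF u] by auto
  have "lozB u \<in> lozenges" using lozB[OF P(1)] by blast
  then have r: "red (lozB u) \<in> P0" "color (red (lozB u)) = 0" by (auto simp: lozenges_def)
  have *: "lozB u \<in> Loz_in v t \<longleftrightarrow> inside (red (lozB u))" using r by (simp add: Loz_in_iff)
  consider "color u = 0" | "color u = 1" | "color u = 2" using color_le_2 by blast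
  then show ?thesis
  proof cases
    case 1
    then show ?thesis using P unfolding bL_Loz_in[OF P(1)] * by (simp add: lozB_def)
  next
    case 2
    then show ?thesis using P green_less[OF P(1) 2] hC_eq[of u]
      unfolding bL_Loz_in[OF P(1)] * by (simp add: lozB_def inside_def; linarith)
  next
    case 3
    then show ?thesis using P blue_less[OF P(1) 3] hC_eq[of u] inside_blue[OF P(1) 3]
      unfolding bL_Loz_in[OF P(1)] * by (simp add: lozB_def inside_def; linarith)
  qed
qed

section \<open>Boundary vertices in coordinates\<close>

lemma bd_even:
  "(\<exists>i\<in>{1..t - 1}. u = bda v t (2 * i)) \<longleftrightarrow> u \<in> P0 \<and> hA u = int t \<and> hB u < int t \<and> hC u < int t"
  "(\<exists>i\<in>{1..t - 1}. u = bdb v t (2 * i)) \<longleftrightarrow> u \<in> P0 \<and> hB u = int t \<and> hA u < int t \<and> hC u < int t"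
  "(\<exists>i\<in>{1..t - 1}. u = bdc v t (2 * i)) \<longleftrightarrow> u \<in> P0 \<and> hC u = int t \<and> hA u < int t \<and> hB u < int t"
proof -
  obtain i j k x y z where u: "u = (i, j, k)" and v: "v = (x, y, z)" by (metis prod_cases3)
  have z: "z = - x - y" using vP0 by (auto simp: v P0_def)
  show "(\<exists>i\<in>{1..t - 1}. u = bda v t (2 * i)) \<longleftrightarrow> u \<in> P0 \<and> hA u = int t \<and> hB u < int t \<and> hC u < int t"
    (is "?L \<longleftrightarrow> ?R")
  proof
    show "?L \<Longrightarrow> ?R" unfolding hA_def hB_def hC_def by (auto simp: u v z bda_def P0_def Let_def)
    show ?L if ?R
      using that unfolding hA_def hB_def hC_def by (intro bexI[of _ "nat (i - x)"]) (auto simp: u v z bda_def P0_def Let_def)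
  qed
  show "(\<exists>i\<in>{1..t - 1}. u = bdb v t (2 * i)) \<longleftrightarrow> u \<in> P0 \<and> hB u = int t \<and> hA u < int t \<and> hC u < int t"
    (is "?L \<longleftrightarrow> ?R")
  proof
    show "?L \<Longrightarrow> ?R" unfolding hA_def hB_def hC_def by (auto simp: u v z bdb_def P0_def Let_def)
    show ?L if ?R
      using that unfolding hA_def hB_def hC_def by (intro bexI[of _ "nat (k - z)"]) (auto simp: u v z bdb_def P0_def Let_def)
  qed
  show "(\<exists>i\<in>{1..t - 1}. u = bdc v t (2 * i)) \<longleftrightarrow> u \<in> P0 \<and> hC u = int t \<and> hA u < int t \<and> hB u < int t"
    (is "?L \<longleftrightarrow> ?R")
  proof
    show "?L \<Longrightarrow> ?R" unfolding hA_def hB_def hC_def by (auto simp: u v z bdc_def P0_def Let_def)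
    show ?L if ?R
      using that unfolding hA_def hB_def hC_def by (intro bexI[of _ "nat (j - y)"]) (auto simp: u v z bdc_def P0_def Let_def)
  qed
qed

lemma bd_odd:
  "(\<exists>i\<in>{0..t - 1}. u = bda v t (2 * i + 1)) \<longleftrightarrow> u \<in> P0 \<and> hA u = int t - 1 \<and> hB u < int t \<and> hC u < int t"
  "(\<exists>i\<in>{0..t - 1}. u = bdb v t (2 * i + 1)) \<longleftrightarrow> u \<in> P0 \<and> hB u = int t - 1 \<and> hA u < int t \<and> hC u < int t"
  "(\<exists>i\<in>{0..t - 1}. u = bdc v t (2 * i + 1)) \<longleftrightarrow> u \<in> P0 \<and> hC u = int t - 1 \<and> hA u < int t \<and> hB u < int t"
proof -
  obtain i j k x y z where u: "u = (i, j, k)" and v: "v = (x, y, z)" by (metis prod_cases3)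
  have z: "z = - x - y" using vP0 by (auto simp: v P0_def)
  show "(\<exists>i\<in>{0..t - 1}. u = bda v t (2 * i + 1)) \<longleftrightarrow> u \<in> P0 \<and> hA u = int t - 1 \<and> hB u < int t \<and> hC u < int t"
    (is "?L \<longleftrightarrow> ?R")
  proof
    show "?L \<Longrightarrow> ?R" using t2 unfolding hA_def hB_def hC_def by (auto simp: u v z bda_def P0_def Let_def)
    show ?L if ?R
      using that unfolding hA_def hB_def hC_def by (intro bexI[of _ "nat (i - x)"]) (auto simp: u v z bda_def P0_def Let_def)
  qed
  show "(\<exists>i\<in>{0..t - 1}. u = bdb v t (2 * i + 1)) \<longleftrightarrow> u \<in> P0 \<and> hB u = int t - 1 \<and> hA u < int t \<and> hC u < int t"
    (is "?L \<longleftrightarrow> ?R")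
  proof
    show "?L \<Longrightarrow> ?R" using t2 unfolding hA_def hB_def hC_def by (auto simp: u v z bdb_def P0_def Let_def)
    show ?L if ?R
      using that unfolding hA_def hB_def hC_def by (intro bexI[of _ "nat (k - z)"]) (auto simp: u v z bdb_def P0_def Let_def)
  qed
  show "(\<exists>i\<in>{0..t - 1}. u = bdc v t (2 * i + 1)) \<longleftrightarrow> u \<in> P0 \<and> hC u = int t - 1 \<and> hA u < int t \<and> hB u < int t"
    (is "?L \<longleftrightarrow> ?R")
  proof
    show "?L \<Longrightarrow> ?R" using t2 unfolding hA_def hB_def hC_def by (auto simp: u v z bdc_def P0_def Let_def)
    show ?L if ?R
      using that unfolding hA_def hB_def hC_def by (intro bexI[of _ "nat (j - y)"]) (auto simp: u v z bdc_def P0_def Let_def)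
  qed
qed

text \<open>By residues a coordinate equals \<open>t\<close> only at green vertices and
  \<open>t - 1\<close> only at blue ones, so even indices give green vertices and odd indices blue
  ones. The strict inequalities of \<open>bd_even\<close> are automatic on \<open>Vert v t\<close>
  because the corners of the triangle are not vertices of the region.\<close>

lemma boundary_iff:
  assumes "u \<in> Vert v t"
  shows "u \<in> boundary v t \<longleftrightarrow> color u = 1 \<and> (hA u = int t \<or> hB u = int t \<or> hC u = int t) \<or>
    color u = 2 \<and> (hA u = int t - 1 \<or> hB u = int t - 1 \<or> hC u = int t - 1)"
proof -
  have P: "u \<in> P0" "inside u" using Vert_inside[OF assms] by auto
  have split: "{1..2 * t - 1} = (\<lambda>i. 2 * i) ` {1..t - 1} \<union> (\<lambda>i. 2 * i + 1) ` {0..t - 1}"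
    using t2 by (auto simp: image_iff; presburger)
  have "u \<in> boundary v t \<longleftrightarrow>
    (\<exists>i\<in>{1..t - 1}. u = bda v t (2 * i)) \<or> (\<exists>i\<in>{1..t - 1}. u = bdb v t (2 * i)) \<or> (\<exists>i\<in>{1..t - 1}. u = bdc v t (2 * i)) \<or>
    (\<exists>i\<in>{0..t - 1}. u = bda v t (2 * i + 1)) \<or> (\<exists>i\<in>{0..t - 1}. u = bdb v t (2 * i + 1)) \<or> (\<exists>i\<in>{0..t - 1}. u = bdc v t (2 * i + 1))"
    unfolding boundary_def split by blast
  also have "\<dots> \<longleftrightarrow> color u = 1 \<and> (hA u = int t \<or> hB u = int t \<or> hC u = int t) \<or>
    color u = 2 \<and> (hA u = int t - 1 \<or> hB u = int t - 1 \<or> hC u = int t - 1)"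
  proof -
    consider "color u = 0" | "color u = 1" | "color u = 2" using color_le_2 by blast
    then show ?thesis
    proof cases
      case 1
      then show ?thesis using P inside_red[OF P(1) 1] unfolding bd_even bd_odd by auto
    next
      case 2
      have no: "hA u \<noteq> int t - 1" "hB u \<noteq> int t - 1" "hC u \<noteq> int t - 1"
        using green_less[OF P(1) 2] by linarith+
      have lt: "hA u = int t \<longrightarrow> hB u < int t \<and> hC u < int t" "hB u = int t \<longrightarrow> hA u < int t \<and> hC u < int t"
        "hC u = int t \<longrightarrow> hA u < int t \<and> hB u < int t"
        using Vert_green[OF assms 2] P(2) unfolding inside_def by linarith+
      have "(hA u = int t \<and> hB u < int t \<and> hC u < int t) = (hA u = int t)"
        "(hB u = int t \<and> hA u < int t \<and> hC u < int t) = (hB u = int t)"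
        "(hC u = int t \<and> hA u < int t \<and> hB u < int t) = (hC u = int t)"
        using lt by blast+
      then show ?thesis unfolding bd_even bd_odd by (simp only: no P(1) 2) simp
    next
      case 3
      have "hA u \<le> int t - 1" "hB u \<le> int t - 1" "hC u \<le> int t - 1"
        using P(2) inside_blue[OF P(1) 3] by simp_all
      then show ?thesis using P(1) 3 unfolding bd_even bd_odd by auto
    qed
  qed
  finally show ?thesis .
qed

lemma source_boundary: "u \<in> Vert v t \<Longrightarrow> u \<notin> dL ` Loz_in v t \<Longrightarrow> u \<in> boundary v t"
  unfolding boundary_iff dL_image by blast

lemma finite_Vert: "finite (Vert v t)"
proof -
  define I where "I = {- 2 * int t - 3 * \<bar>fst v\<bar> - 3 * \<bar>fst (snd v)\<bar> - 3 * \<bar>snd (snd v)\<bar> ..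
    2 * int t + 3 * \<bar>fst v\<bar> + 3 * \<bar>fst (snd v)\<bar> + 3 * \<bar>snd (snd v)\<bar>}"
  have "Vert v t \<subseteq> I \<times> I \<times> I"
  proof
    fix u assume "u \<in> Vert v t"
    then have "u \<in> P0" "inside u" using Vert_inside by auto
    then show "u \<in> I \<times> I \<times> I" using vP0 unfolding inside_def hA_def hB_def hC_def
      by (cases u; cases v) (auto simp: I_def P0_def)
  qed
  then show ?thesis by (rule finite_subset) (simp add: I_def)
qed

lemma finite_Loz_in: "finite (Loz_in v t)"
proof (rule finite_imageD[of dL])
  show "finite (dL ` Loz_in v t)"
    by (rule finite_subset[OF _ finite_Vert]) (auto simp: Vert_def corners_def)
  show "inj_on dL (Loz_in v t)"
    by (metis inj_onI lozD_dL Loz_in_lozenges)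
qed

end

section \<open>Height functions of circulations\<close>

text \<open>On \<open>P0\<close> this coordinate measures the position along
  \<open>e23 - e12\<close>, the direction from \<open>bL L\<close> to \<open>dL L\<close>.\<close>

definition jc :: "vec3 \<Rightarrow> int" where "jc u = fst (snd u)"

lemma jc_simps [simp]: "jc (u + w) = jc u + jc w" "jc (u - w) = jc u - jc w" "jc (i, j, k) = j"
  by (simp_all add: jc_def)

text \<open>\<open>w p q\<close> is the net flow from \<open>p\<close> to \<open>q\<close>.
  Conservation is required for all finite sets containing the support, which avoids sums over the
  infinite lattice. Below level \<open>m\<close> there is no flow, so heights can be anchored
  there.\<close>

locale circulation = region +
  fixes w :: "vec3 \<Rightarrow> vec3 \<Rightarrow> int" and m :: int
  assumes anti: "w p q = - w q p"
    and supp: "w p q \<noteq> 0 \<Longrightarrow> \<exists>L\<in>Loz_in v t. {p, q} \<in> diagonals L"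
    and low: "w p q \<noteq> 0 \<Longrightarrow> m \<le> jc p"
    and cons: "finite S \<Longrightarrow> (\<And>q. w u q \<noteq> 0 \<Longrightarrow> q \<in> S) \<Longrightarrow> (\<Sum>q\<in>S. w u q) = 0"
begin

text \<open>The total flow across the horizontal ray that leaves p in the direction of decreasing j.\<close>

function hgt :: "vec3 \<Rightarrow> int" where
  "hgt p = (if jc p \<le> m then 0
    else if color p = 0 then hgt (p + e12) + w (p - e23) (p - e31)
    else if color p = 1 then hgt (p + e12 - e23) + w (p + e12) (p - e23)
    else hgt (p - e23) - w (p + e12) (p + e31))"
  by auto
termination by (relation "Wellfounded.measure (\<lambda>p. nat (jc p - m))") auto

declare hgt.simps [simp del]

lemma w_low: "jc p < m \<Longrightarrow> w p q = 0" "jc q < m \<Longrightarrow> w p q = 0"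
  using low[of p q] low[of q p] anti[of p q] by linarith+

lemma hgt_low: "jc p \<le> m \<Longrightarrow> hgt p = 0"
  by (subst hgt.simps) simp

text \<open>Each recursion step goes from \<open>dL L\<close> to \<open>bL L\<close>, where
  \<open>L\<close> is the lozenge with \<open>p\<close> as \<open>dL L\<close>, and adds the flow
  along the other diagonal. So for each type of lozenge the relation across the diagonal of
  \<open>aL L\<close> and \<open>cL L\<close> holds by construction; at and below level
  \<open>m\<close> both sides vanish.\<close>

lemma hgt_red: "color r = 0 \<Longrightarrow> hgt r = hgt (r + e12) + w (r - e23) (r - e31)"
  by (cases "jc r \<le> m") (simp_all add: hgt_low w_low hgt.simps[of r])

lemma hgt_green: "color g = 1 \<Longrightarrow> hgt g = hgt (g + e12 - e23) + w (g + e12) (g - e23)"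
  by (cases "jc g \<le> m") (simp_all add: hgt_low w_low hgt.simps[of g])

lemma hgt_blue: "color s = 2 \<Longrightarrow> hgt s = hgt (s - e23) - w (s + e12) (s + e31)"
  by (cases "jc s \<le> m") (simp_all add: hgt_low w_low hgt.simps[of s])

text \<open>Separates the flow on the honeycomb of red-blue diagonals, with three neighbours per
  vertex, from the flow on the green triangular lattice, with six.\<close>

lemma supp_cases:
  assumes "w p q \<noteq> 0"
  obtains r where "color r = 0" "p = r \<and> q \<in> {r + e12, r + e23, r + e31} \<or> q = r \<and> p \<in> {r + e12, r + e23, r + e31}"
  | r where "color r = 0" "p \<noteq> q" "p \<in> {r - e12, r - e23, r - e31}" "q \<in> {r - e12, r - e23, r - e31}"
proof -
  obtain L where L: "L \<in> Loz_in v t" "{p, q} \<in> diagonals L" using supp assms by blast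
  then have "color (red L) = 0" by (simp add: Loz_in_iff)
  moreover have "p = red L \<and> q \<in> {red L + e12, red L + e23, red L + e31} \<or>
     q = red L \<and> p \<in> {red L + e12, red L + e23, red L + e31} \<or>
     p \<in> {red L - e12, red L - e23, red L - e31} \<and> q \<in> {red L - e12, red L - e23, red L - e31}"
    using L(2) by (cases L; cases "rbdir L") (auto simp: diagonals_def doubleton_eq_iff)
  moreover have "p \<noteq> q" using assms anti[of p q] by auto
  ultimately show ?thesis using that by blast
qed

lemma cons_red:
  assumes "color r = 0"
  shows "w r (r + e12) + w r (r + e23) + w r (r + e31) = 0"
proof -
  have "(\<Sum>q\<in>{r + e12, r + e23, r + e31}. w r q) = 0"
  proof (rule cons)
    fix q assume "w r q \<noteq> 0"
    then show "q \<in> {r + e12, r + e23, r + e31}"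
    proof (cases rule: supp_cases)
      case (1 r')
      then show ?thesis using assms color_steps[of r'] by auto
    next
      case (2 r')
      then show ?thesis using assms color_steps[of r'] by auto
    qed
  qed simp
  then show ?thesis by simp
qed

lemma cons_blue:
  assumes "color s = 2"
  shows "w s (s - e12) + w s (s - e23) + w s (s - e31) = 0"
proof -
  have "(\<Sum>q\<in>{s - e12, s - e23, s - e31}. w s q) = 0"
  proof (rule cons)
    fix q assume "w s q \<noteq> 0"
    then show "q \<in> {s - e12, s - e23, s - e31}"
    proof (cases rule: supp_cases)
      case (1 r')
      then have "q = r'" "s \<in> {r' + e12, r' + e23, r' + e31}" using assms by auto
      then show ?thesis by auto
    next
      case (2 r')
      then show ?thesis using assms color_steps[of r'] by auto
    qed
  qed simp
  then show ?thesis by simp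
qed

lemma cons_green:
  assumes "color g = 1"
  shows "w g (g + e23 - e31) + w g (g + e31 - e23) + w g (g + e31 - e12) + w g (g + e12 - e31)
    + w g (g + e12 - e23) + w g (g + e23 - e12) = 0"
proof -
  have "(\<Sum>q\<in>{g + e23 - e31, g + e31 - e23, g + e31 - e12, g + e12 - e31, g + e12 - e23, g + e23 - e12}. w g q) = 0"
  proof (rule cons)
    fix q assume "w g q \<noteq> 0"
    then show "q \<in> {g + e23 - e31, g + e31 - e23, g + e31 - e12, g + e12 - e31, g + e12 - e23, g + e23 - e12}"
    proof (cases rule: supp_cases)
      case (1 r)
      then show ?thesis using assms color_steps[of r] by auto
    next
      case (2 r)
      from 2(3) have "r \<in> {g + e12, g + e23, g + e31}" by auto
      then show ?thesis using 2(2,3,4) by auto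
    qed
  qed simp
  moreover have "distinct [g + e23 - e31, g + e31 - e23, g + e31 - e12, g + e12 - e31, g + e12 - e23, g + e23 - e12]"
    by (cases g) simp
  ultimately show ?thesis by (simp add: add.assoc)
qed

section \<open>Heights as potentials of the dual flow\<close>

lemma height_nongreen31:
  assumes "color r = 0" shows "w r (r + e31) = hgt (r - e12) - hgt (r - e23)"
  using hgt_green[of "r - e12"] color_steps[OF assms] by (cases r) simp

text \<open>Conservation at the blue vertex \<open>r + e12\<close> expresses the first relation by
  the second one at a red vertex two levels lower and by the relation that holds by construction;
  conservation at \<open>r\<close> then gives the second. Hence both are carried through one
  induction.\<close>

lemma height_nongreen:
  assumes "color r = 0"
  shows "w r (r + e12) = hgt (r - e23) - hgt (r - e31) \<and> w r (r + e23) = hgt (r - e31) - hgt (r - e12)"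
  using assms
proof (induction "nat (jc r - m)" arbitrary: r rule: less_induct)
  case less
  have T1: "w r (r + e12) = hgt (r - e23) - hgt (r - e31)"
  proof (cases "jc r \<le> m")
    case True
    then show ?thesis by (simp add: w_low hgt_low)
  next
    case False
    let ?s = "r + e12"
    have c: "color ?s = 2" "color (?s - e23) = 0" "color (?s - e31) = 0"
      using less.prems unfolding color_crdB by (simp; presburger)+
    have "w (?s - e23) (?s - e23 + e23) = hgt (?s - e23 - e31) - hgt (?s - e23 - e12)"
      using less.hyps[of "?s - e23"] c False by simp
    moreover have "w (?s - e31) (?s - e31 + e31) = hgt (?s - e31 - e12) - hgt (?s - e31 - e23)"
      using height_nongreen31 c by blast
    ultimately show ?thesis
      using cons_blue[OF c(1)] anti[of ?s "?s - e23"] anti[of ?s "?s - e31"] anti[of ?s r]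
      by (cases r) (simp add: algebra_simps)
  qed
  then show ?case using cons_red[OF less.prems] height_nongreen31[OF less.prems] by simp
qed

lemma height_green12:
  "color r = 0 \<Longrightarrow> hgt r - hgt (r + e12) = w (r - e23) (r - e31)"
  using hgt_red by simp

lemma height_green23:
  assumes "color r = 0" shows "hgt r - hgt (r + e23) = w (r - e31) (r - e12)"
  using hgt_blue[of "r + e23"] color_steps[OF assms] by (cases r) simp

text \<open>Conservation at the green vertex \<open>r - e23\<close> involves six lozenges. Four of
  their relations hold by construction, one is the induction hypothesis at a red vertex two levels
  lower, and the sixth is the claim.\<close>

lemma height_green31:
  assumes "color r = 0" shows "hgt r - hgt (r + e31) = w (r - e12) (r - e23)"
  using assms
proof (induction "nat (jc r - m)" arbitrary: r rule: less_induct)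
  case less
  show ?case
  proof (cases "jc r \<le> m")
    case True
    then show ?thesis by (simp add: w_low hgt_low)
  next
    case False
    let ?g = "r - e23"
    have c: "color ?g = 1" "color (?g + e12) = 0" "color (?g + e31) = 0" "color (?g + e23) = 0"
      using less.prems unfolding color_crdB by (simp; presburger)+
    have "hgt (?g + e12) - hgt (?g + e12 + e31) = w (?g + e12 - e12) (?g + e12 - e23)"
      using less.hyps[of "?g + e12"] c False by simp
    then show ?thesis
      using cons_green[OF c(1)] height_green12[OF c(3)] height_green12[OF c(4)]
        height_green23[OF c(2)] height_green23[OF c(3)]
        anti[of ?g "?g + e31 - e23"] anti[of ?g "?g + e12 - e31"] anti[of ?g "?g + e23 - e12"]
      by (cases r) (simp add: algebra_simps)
  qed
qed

text \<open>The signs depend on the type of lozenge; absolute values unify the three types and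
  suffice, since only the vanishing of differences is used afterwards.\<close>

lemma height_diagonals:
  assumes "L \<in> lozenges"
  shows "\<bar>hgt (aL L) - hgt (cL L)\<bar> = \<bar>w (bL L) (dL L)\<bar>" "\<bar>hgt (bL L) - hgt (dL L)\<bar> = \<bar>w (aL L) (cL L)\<bar>"
proof -
  obtain r e where L: "L = Loz r e" by (cases L)
  have r: "color r = 0" using assms by (simp add: L lozenges_def)
  note h = height_nongreen[OF r] height_nongreen31[OF r] height_green12[OF r] height_green23[OF r] height_green31[OF r]
  show "\<bar>hgt (aL L) - hgt (cL L)\<bar> = \<bar>w (bL L) (dL L)\<bar>"
    using h anti[of "r + e12" r] anti[of "r + e23" r] anti[of "r - e12" "r - e23"]
    unfolding L by (cases e) auto
  show "\<bar>hgt (bL L) - hgt (dL L)\<bar> = \<bar>w (aL L) (cL L)\<bar>"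
    using h anti[of "r + e31" r] anti[of "r - e12" "r - e31"] anti[of "r - e23" "r - e31"]
    unfolding L by (cases e) (auto simp: abs_minus_commute)
qed

lemma height_opposite:
  assumes "L \<in> lozenges" "u \<in> corners L"
    and "\<And>x y. {x, y} \<in> diagonals L \<Longrightarrow> u \<noteq> x \<Longrightarrow> u \<noteq> y \<Longrightarrow> w x y = 0"
  shows "hgt (ctr L - u) = hgt u"
  using assms(2)
proof (rule corner_cases)
  assume u: "u = aL L"
  then show ?thesis using assms(3)[of "bL L" "dL L"] height_diagonals[OF assms(1)] corners_neq[of L]
    unfolding u ctr_minus by (simp add: diagonals_def)
next
  assume u: "u = bL L"
  then show ?thesis using assms(3)[of "aL L" "cL L"] height_diagonals[OF assms(1)] corners_neq[of L, symmetric]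
    unfolding u ctr_minus by (simp add: diagonals_def)
next
  assume u: "u = cL L"
  then show ?thesis using assms(3)[of "bL L" "dL L"] height_diagonals[OF assms(1)] corners_neq[of L] corners_neq(4)[of L, symmetric]
    unfolding u ctr_minus by (simp add: diagonals_def)
next
  assume u: "u = dL L"
  then show ?thesis using assms(3)[of "aL L" "cL L"] height_diagonals[OF assms(1)] corners_neq[of L, symmetric]
    unfolding u ctr_minus by (simp add: diagonals_def)
qed

lemma height_nonzero:
  assumes "L \<in> lozenges" "u \<in> corners L" "w u (ctr L - u) \<noteq> 0"
  shows "\<exists>x\<in>corners L. hgt x \<noteq> 0"
proof (rule ccontr)
  assume "\<not> ?thesis"
  then have "w (bL L) (dL L) = 0" "w (aL L) (cL L) = 0"
    using height_diagonals[OF assms(1)] by (simp_all add: corners_def)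
  then have "w (aL L) (cL L) = 0" "w (cL L) (aL L) = 0" "w (bL L) (dL L) = 0" "w (dL L) (bL L) = 0"
    using anti[of "dL L" "bL L"] anti[of "cL L" "aL L"] by simp_all
  moreover from assms(2) have "w u (ctr L - u) \<in> {w (aL L) (cL L), w (cL L) (aL L), w (bL L) (dL L), w (dL L) (bL L)}"
    by (rule corner_cases) (simp_all add: ctr_minus)
  ultimately show False using assms(3) by simp
qed

section \<open>Heights vanish beyond the sides and on the boundary\<close>

lemma height_eq:
  assumes "L \<in> lozenges" "{p, q} \<in> diagonals L" "L \<notin> Loz_in v t"
  shows "hgt p = hgt q"
proof -
  have *: "w x y = 0" if "{x, y} \<in> diagonals L" for x y
    using supp[of x y] diagonal_unique[OF that] assms(3) by blast
  have "w (bL L) (dL L) = 0" "w (aL L) (cL L) = 0"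
    by (rule *, simp add: diagonals_def)+
  then show ?thesis using height_diagonals[OF assms(1)] assms(2)
    by (auto simp: diagonals_def doubleton_eq_iff)
qed

lemma height_outside:
  assumes "r \<in> P0" "color r = 0" "hA r > int t \<or> hB r > int t \<or> hC r > int t"
    "{p, q} \<in> diagonals (Loz r e)"
  shows "hgt p = hgt q"
  by (rule height_eq[of "Loz r e"]) (use assms in \<open>simp_all add: lozenges_def Loz_in_iff inside_def not_le\<close>)

text \<open>Rounding up to the next residue of the color puts red vertices outside the triangle and
  provides the slack for steps that lower a coordinate.\<close>

lemma residue_bounds:
  assumes "u \<in> P0"
  shows "color u = 0 \<Longrightarrow> hA u \<ge> int t - 1 \<longleftrightarrow> hA u > int t" "color u = 0 \<Longrightarrow> hB u \<ge> int t - 1 \<longleftrightarrow> hB u > int t"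
    "color u = 0 \<Longrightarrow> hC u \<ge> int t - 1 \<longleftrightarrow> hC u > int t"
    "color u = 1 \<Longrightarrow> hB u \<ge> int t - 1 \<longleftrightarrow> hB u \<ge> int t"
    "color u = 2 \<Longrightarrow> hA u \<ge> int t \<longleftrightarrow> hA u > int t + 1"
    "color u = 2 \<Longrightarrow> hC u \<ge> int t \<longleftrightarrow> hC u > int t + 1"
  by (rule residues[OF assms]; simp add: hC_eq; presburger)+

lemma color_back:
  "color g = 1 \<Longrightarrow> color (g + e12) = 0" "color g = 1 \<Longrightarrow> color (g + e23) = 0"
  "color s = 2 \<Longrightarrow> color (s - e12) = 0" "color s = 2 \<Longrightarrow> color (s - e23) = 0"
  "color s = 2 \<Longrightarrow> color (s - e31) = 0"
  unfolding color_crdB by (simp; presburger)+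

text \<open>Every step of the ray that defines the height raises \<open>hB\<close>. The ray thus
  stays beyond side B, where no lozenge carries flow.\<close>

lemma height_B:
  assumes "p \<in> P0" "hB p \<ge> int t - 1" shows "hgt p = 0"
  using assms
proof (induction "nat (jc p - m)" arbitrary: p rule: less_induct)
  case less
  show ?case
  proof (cases "jc p \<le> m")
    case False
    note IH = less.hyps
    show ?thesis
    proof (cases p rule: color_cases)
      case red
      have "hgt p = hgt (p + e12)"
        by (rule height_outside[of p _ _ D12]) (use less.prems red residue_bounds(2) in \<open>auto simp: diagonals_def\<close>)
      then show ?thesis using IH[of "p + e12"] False less.prems by simp
    next
      case green
      have "hgt p = hgt (p + e12 - e23)"
        by (rule height_outside[of "p + e12" _ _ D31])
          (use less.prems green residue_bounds(4) color_back in \<open>auto simp: diagonals_def\<close>)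
      then show ?thesis using IH[of "p + e12 - e23"] False less.prems by simp
    next
      case blue
      have "hgt p = hgt (p - e23)"
        by (rule height_outside[of "p - e23" _ _ D23])
          (use less.prems blue color_back in \<open>auto simp: diagonals_def\<close>)
      then show ?thesis using IH[of "p - e23"] False less.prems by simp
    qed
  qed (simp add: hgt_low)
qed

text \<open>The ray runs parallel to side A. Only a step from a blue vertex lowers
  \<open>hA\<close>, by 1, and a blue vertex with \<open>hA\<close> at least \<open>t\<close> has
  \<open>hA\<close> at least \<open>t + 2\<close>. From level \<open>t - 1\<close> such a step would
  enter the triangle, whence the weaker threshold than in \<open>height_B\<close>.\<close>

lemma height_A:
  assumes "p \<in> P0" "hA p \<ge> int t" shows "hgt p = 0"
  using assms
proof (induction "nat (jc p - m)" arbitrary: p rule: less_induct)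
  case less
  show ?case
  proof (cases "jc p \<le> m")
    case False
    note IH = less.hyps
    show ?thesis
    proof (cases p rule: color_cases)
      case red
      have "hgt p = hgt (p + e12)"
        by (rule height_outside[of p _ _ D12]) (use less.prems red residue_bounds(1)[of p] in \<open>auto simp: diagonals_def\<close>)
      then show ?thesis using IH[of "p + e12"] False less.prems by simp
    next
      case green
      have "hgt p = hgt (p + e12 - e23)"
        by (rule height_outside[of "p + e12" _ _ D31])
          (use less.prems green color_back in \<open>auto simp: diagonals_def\<close>)
      then show ?thesis using IH[of "p + e12 - e23"] False less.prems by simp
    next
      case blue
      have "hgt p = hgt (p - e23)"
        by (rule height_outside[of "p - e23" _ _ D23])
          (use less.prems blue color_back residue_bounds(5)[of p] in \<open>auto simp: diagonals_def\<close>)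
      then show ?thesis using IH[of "p - e23"] False less.prems residue_bounds(5)[of p] blue by simp
    qed
  qed (simp add: hgt_low)
qed

text \<open>The ray from a vertex beyond side C may cross the region. Instead the heights are
  compared along a walk parallel to side C, through lozenges without flow, until side A is
  passed.\<close>

lemma height_C:
  assumes "p \<in> P0" "hC p \<ge> int t" shows "hgt p = 0"
  using assms
proof (induction "nat (int t - hA p)" arbitrary: p rule: less_induct)
  case less
  show ?case
  proof (cases "hA p \<ge> int t")
    case False
    note IH = less.hyps
    show ?thesis
    proof (cases p rule: color_cases)
      case red
      have "hgt p = hgt (p + e23)"
        by (rule height_outside[of p _ _ D23]) (use less.prems red residue_bounds(3)[of p] in \<open>auto simp: diagonals_def\<close>)
      then show ?thesis using IH[of "p + e23"] False less.prems by simp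
    next
      case green
      have "hgt p = hgt (p + e23 - e31)"
        by (rule height_outside[of "p + e23" _ _ D12])
          (use less.prems green color_back in \<open>auto simp: diagonals_def\<close>)
      then show ?thesis using IH[of "p + e23 - e31"] False less.prems by simp
    next
      case blue
      have "hgt p = hgt (p - e31)"
        by (rule height_outside[of "p - e31" _ _ D31])
          (use less.prems blue color_back residue_bounds(6)[of p] in \<open>auto simp: diagonals_def\<close>)
      then show ?thesis using IH[of "p - e31"] False less.prems residue_bounds(6)[of p] blue by simp
    qed
  qed (use less.prems height_A in simp)
qed

lemma height_boundary:
  assumes u: "u \<in> Vert v t" "u \<in> boundary v t" shows "hgt u = 0"
proof -
  have P: "u \<in> P0" using Vert_inside[OF u(1)] by blast
  \<comment> \<open>Blue boundary vertices at level \<open>t - 1\<close> fall short of the threshold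
    of \<open>height_A\<close>; a lozenge on the outer side joins \<open>u\<close> to a vertex at
    level \<open>t + 1\<close> of the same height. The same is done for side C.\<close>
  have A: "hgt u = 0" if "color u = 2" "hA u = int t - 1"
  proof -
    have "hgt u = hgt (u - e31)"
      by (rule height_outside[of "u - e31" _ _ D31]) (use that P color_back in \<open>auto simp: diagonals_def\<close>)
    then show ?thesis using height_A[of "u - e31"] that P by simp
  qed
  have C: "hgt u = 0" if "color u = 2" "hC u = int t - 1"
  proof -
    have "hgt u = hgt (u - e12)"
      by (rule height_outside[of "u - e12" _ _ D12]) (use that P color_back in \<open>auto simp: diagonals_def\<close>)
    then show ?thesis using height_C[of "u - e12"] that P by simp
  qed
  show ?thesis
    using u(2) A C height_A[OF P] height_B[OF P] height_C[OF P] unfolding boundary_iff[OF u(1)] by force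
qed

end

section \<open>Tail assignments\<close>

text \<open>A tail assignment selects from each lozenge the tail of its oriented diagonal.  Both the
  rooted forests and the r-paths are determined by their tail assignments: an r-path avoids the
  center of L if and only if the tail is d_L.\<close>

definition tail_assignment :: "vec3 \<Rightarrow> nat \<Rightarrow> (lozenge \<Rightarrow> vec3) \<Rightarrow> bool" where
  "tail_assignment v t \<tau> \<longleftrightarrow> (\<forall>L\<in>Loz_in v t. \<tau> L \<in> corners L) \<and> inj_on \<tau> (Loz_in v t) \<and>
     Vert v t - \<tau> ` Loz_in v t \<subseteq> boundary v t"

locale tails = region +
  fixes \<tau> :: "lozenge \<Rightarrow> vec3"
  assumes ta: "tail_assignment v t \<tau>"
begin

definition D :: "vec3 set" where "D = \<tau> ` Loz_in v t"

definition lz :: "vec3 \<Rightarrow> lozenge" where "lz = the_inv_into (Loz_in v t) \<tau>"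

definition f :: "vec3 \<Rightarrow> vec3" where "f u = ctr (lz u) - u"

lemma \<tau>_corner: "L \<in> Loz_in v t \<Longrightarrow> \<tau> L \<in> corners L"
  using ta by (auto simp: tail_assignment_def)

lemma lz_\<tau>: "L \<in> Loz_in v t \<Longrightarrow> lz (\<tau> L) = L"
  using ta by (auto simp: tail_assignment_def lz_def the_inv_into_f_f)

lemma lz: assumes "u \<in> D" shows "lz u \<in> Loz_in v t" "\<tau> (lz u) = u" "u \<in> corners (lz u)"
  using assms lz_\<tau> \<tau>_corner by (auto simp: D_def)

lemma f: assumes "u \<in> D"
  shows "f u \<noteq> u" "f u \<in> corners (lz u)" "f u \<in> Vert v t" "{u, f u} \<in> diagonals (lz u)"
  using lz[OF assms] opp_neq opp_corner corner_diagonal corner_Vert by (auto simp: f_def)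

lemma D_Vert: "D \<subseteq> Vert v t"
  using lz corner_Vert by blast

lemma notin_D: "u \<in> Vert v t \<Longrightarrow> u \<notin> D \<Longrightarrow> u \<in> boundary v t"
  using ta by (auto simp: tail_assignment_def D_def)

text \<open>\<open>Z\<close> is a union of cycles, and \<open>Z'\<close> is found among the vertices
  that they enclose: an orbit starting there cannot cross \<open>Z\<close>, so it is
  trapped.\<close>

lemma cycle_descent:
  assumes Z: "Z \<subseteq> D" "Z \<noteq> {}" "f ` Z = Z"
  shows "\<exists>Z'\<subseteq>D. Z' \<noteq> {} \<and> f ` Z' = Z' \<and> Min (jc ` Z) < Min (jc ` Z')"
proof -
  have fin: "finite Z" using Z(1) D_Vert finite_Vert finite_subset by metis
  have inj: "inj_on f Z" using Z(3) fin by (simp add: eq_card_imp_inj_on)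
  define m where "m = Min (jc ` Z)"
  \<comment> \<open>One unit of flow along each arc from \<open>u\<close> to \<open>f u\<close>,
    made antisymmetric; that no two arcs cancel is shown further below.\<close>
  define w where "w p q = of_bool (p \<in> Z \<and> f p = q) - (of_bool (q \<in> Z \<and> f q = p) :: int)" for p q
  have w_ne: "p \<in> Z \<and> f p = q \<or> q \<in> Z \<and> f q = p" if "w p q \<noteq> 0" for p q
    using that by (auto simp: w_def split: if_splits)
  interpret circulation v t w m
  proof
    show "w p q = - w q p" for p q by (simp add: w_def)
    show "\<exists>L\<in>Loz_in v t. {p, q} \<in> diagonals L" if pq: "w p q \<noteq> 0" for p q
    proof -
      consider "p \<in> D" "f p = q" | "q \<in> D" "f q = p" using w_ne[OF pq] Z(1) by blast
      then show ?thesis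
        using lz(1)[of p] f(4)[of p] lz(1)[of q] f(4)[of q] by cases (auto simp: insert_commute)
    qed
    show "m \<le> jc p" if "w p q \<noteq> 0" for p q
    proof -
      have "p \<in> Z" using w_ne[OF that] Z(3) by auto
      then show ?thesis unfolding m_def using fin by simp
    qed
    show "(\<Sum>q\<in>S. w u q) = 0" if S: "finite S" "\<And>q. w u q \<noteq> 0 \<Longrightarrow> q \<in> S" for S u
    proof -
      \<comment> \<open>The range of summation is enlarged so that it contains the target
        \<open>f u\<close> and all possible predecessors of \<open>u\<close>; outflow and inflow can
        then be summed separately.\<close>
      have "(\<Sum>q\<in>S. w u q) = (\<Sum>q\<in>S \<union> Z. w u q)"
        using S fin by (intro sum.mono_neutral_left) auto
      also have "\<dots> = (\<Sum>q\<in>insert (f u) (S \<union> Z). w u q)"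
        using S fin by (intro sum.mono_neutral_left) auto
      finally have s0: "(\<Sum>q\<in>S. w u q) = (\<Sum>q\<in>insert (f u) (S \<union> Z). w u q)" .
      have s1: "(\<Sum>q\<in>insert (f u) (S \<union> Z). w u q) = (\<Sum>q\<in>insert (f u) (S \<union> Z). if q = f u then of_bool (u \<in> Z) else 0)
          - (\<Sum>q\<in>insert (f u) (S \<union> Z). of_bool (q \<in> Z \<and> f q = u))"
        unfolding w_def sum_subtractf by (intro arg_cong2[of _ _ _ _ "(-)"] sum.cong) auto
      have s2: "(\<Sum>q\<in>insert (f u) (S \<union> Z). if q = f u then of_bool (u \<in> Z) else 0) = (of_bool (u \<in> Z) :: int)"
        using S fin by (subst sum.delta) auto
      have s3: "(\<Sum>q\<in>insert (f u) (S \<union> Z). of_bool (q \<in> Z \<and> f q = u)) = (of_bool (u \<in> Z) :: int)"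
      proof (cases "u \<in> Z")
        case True
        then have "u \<in> f ` Z" using Z(3) by simp
        then obtain y where y: "y \<in> Z" "f y = u" by auto
        then have *: "q \<in> Z \<and> f q = u \<longleftrightarrow> q = y" for q using inj by (auto dest: inj_onD)
        have "(\<Sum>q\<in>insert (f u) (S \<union> Z). of_bool (q \<in> Z \<and> f q = u)) =
            (\<Sum>q\<in>insert (f u) (S \<union> Z). if q = y then 1 else 0 :: int)"
          unfolding * of_bool_def ..
        also have "\<dots> = 1" using S fin y by (subst sum.delta) auto
        finally show ?thesis using True by simp
      next
        case False
        then have "u \<notin> f ` Z" using Z(3) by simp
        then have "\<not> (q \<in> Z \<and> f q = u)" for q by auto
        then show ?thesis using False by (intro sum.neutral[THEN trans]) (auto simp: of_bool_def)
      qed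
      show ?thesis unfolding s0 s1 s2 s3 by simp
    qed
  qed
  define S where "S = {p \<in> Vert v t. hgt p \<noteq> 0}"
  have SD: "S \<subseteq> D" using notin_D height_boundary unfolding S_def by blast
  have inv: "f p \<in> S" if "p \<in> S" for p
  proof -
    have pD: "p \<in> D" using SD that by blast
    let ?L = "lz p"
    have L: "?L \<in> Loz_in v t" "p \<in> corners ?L" using lz[OF pD] by auto
    \<comment> \<open>Flow on the other diagonal would come from a second tail in the same lozenge,
      but a lozenge has only the tail \<open>p\<close>.\<close>
    have *: "w x y = 0" if xy: "{x, y} \<in> diagonals ?L" "p \<noteq> x" "p \<noteq> y" for x y
    proof (rule ccontr)
      assume "w x y \<noteq> 0"
      then consider "x \<in> Z" "f x = y" | "y \<in> Z" "f y = x" using w_ne by blast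
      then obtain z where z: "z \<in> {x, y}" "z \<in> Z" "{z, f z} = {x, y}" by cases blast+
      then have "z \<in> D" using Z(1) by blast
      then have "{x, y} \<in> diagonals (lz z)" using f(4)[of z] z(3) by simp
      then have "lz z = ?L" using diagonal_unique xy(1) by blast
      then have "z = p" using lz(2)[OF pD] lz(2)[OF \<open>z \<in> D\<close>] by simp
      then show False using z(1) xy by auto
    qed
    have "hgt (f p) = hgt p"
      unfolding f_def using height_opposite[OF Loz_in_lozenges[OF L(1)] L(2)] * by blast
    then show ?thesis using that f(3)[OF pD] by (simp add: S_def)
  qed
  have "S \<noteq> {}"
  proof -
    obtain z where z: "z \<in> Z" using Z(2) by blast
    then have zD: "z \<in> D" using Z(1) by blast
    \<comment> \<open>Arcs in both directions would make \<open>z\<close> and \<open>f z\<close>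
      tails of one lozenge. Hence the unit of flow from \<open>z\<close> survives and forces a
      nonzero height at a corner.\<close>
    have "\<not> (f z \<in> Z \<and> f (f z) = z)"
    proof
      assume *: "f z \<in> Z \<and> f (f z) = z"
      then have "f z \<in> D" using Z(1) by blast
      then have "{z, f z} \<in> diagonals (lz (f z))" using f(4)[of "f z"] * by (simp add: insert_commute)
      then have "lz (f z) = lz z" using diagonal_unique f(4)[OF zD] by blast
      then show False using lz(2)[OF zD] lz(2)[OF \<open>f z \<in> D\<close>] f(1)[OF zD] by simp
    qed
    then have w1: "w z (f z) = 1" "w (f z) z = - 1" using z by (auto simp: w_def)
    let ?L = "lz z"
    have L: "?L \<in> Loz_in v t" "z \<in> corners ?L" using lz[OF zD] by auto
    obtain x where "x \<in> corners ?L" "hgt x \<noteq> 0"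
      using height_nonzero[OF Loz_in_lozenges[OF L(1)] L(2)] w1(1) unfolding f_def by auto
    then show ?thesis using corner_Vert[OF L(1)] unfolding S_def by blast
  qed
  moreover have "finite S" using finite_Vert by (simp add: S_def)
  moreover have "f ` S \<subseteq> S" using inv by blast
  ultimately obtain Z' where Z': "Z' \<subseteq> S" "Z' \<noteq> {}" "f ` Z' = Z'"
    using finite_invariant_subset by metis
  moreover from this have "finite Z'" using \<open>finite S\<close> finite_subset by blast
  \<comment> \<open>Heights are zero up to level \<open>m\<close> by construction, so the least
    level rises strictly.\<close>
  moreover have "m < jc p" if "p \<in> S" for p
    using that hgt_low[of p] by (force simp: S_def)
  ultimately have "m < Min (jc ` Z')" by (subst Min_gr_iff) auto
  then show ?thesis using Z' SD unfolding m_def by blast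
qed

lemma no_cycle: "Z \<subseteq> D \<Longrightarrow> f ` Z = Z \<Longrightarrow> Z = {}"
proof (induction "nat (Max (jc ` Vert v t) - Min (jc ` Z))" arbitrary: Z rule: less_induct)
  case less
  show ?case
  proof (rule ccontr)
    assume "Z \<noteq> {}"
    then obtain Z' where Z': "Z' \<subseteq> D" "Z' \<noteq> {}" "f ` Z' = Z'" "Min (jc ` Z) < Min (jc ` Z')"
      using cycle_descent[OF less.prems(1) \<open>Z \<noteq> {}\<close> less.prems(2)] by blast
    have fin: "finite Z'" by (rule finite_subset[OF subset_trans[OF Z'(1) D_Vert] finite_Vert])
    obtain z where z: "z \<in> Z'" using Z'(2) by blast
    then have zV: "z \<in> Vert v t" using Z'(1) D_Vert by blast
    have "Min (jc ` Z') \<le> jc z" "jc z \<le> Max (jc ` Vert v t)"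
      by (rule Min_le[OF finite_imageI[OF fin] imageI[OF z]])
        (rule Max_ge[OF finite_imageI[OF finite_Vert] imageI[OF zV]])
    then show False using less.hyps[of Z'] Z' by auto
  qed
qed

text \<open>The vertices whose orbits never leave \<open>D\<close> are mapped into themselves; if
  there were any, some of them would form a set as excluded by \<open>no_cycle\<close>.\<close>

sublocale functional_graph "Vert v t" D f
proof
  show "D \<subseteq> Vert v t" by (rule D_Vert)
  show "f u \<in> Vert v t" if "u \<in> D" for u using f(3) that .
  show "\<exists>n. (f ^^ n) u \<notin> D" if "u \<in> Vert v t" for u
  proof (rule ccontr)
    assume no: "\<not> ?thesis"
    define Q where "Q = {u. \<forall>n. (f ^^ n) u \<in> D}"
    have uQ: "u \<in> Q" using no by (simp add: Q_def)
    have QD: "Q \<subseteq> D" by (auto simp: Q_def dest: spec[of _ 0])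
    moreover have "f ` Q \<subseteq> Q"
    proof (rule image_subsetI)
      fix x assume "x \<in> Q"
      then have "(f ^^ Suc n) x \<in> D" for n unfolding Q_def by blast
      then show "f x \<in> Q" by (simp add: Q_def funpow_swap1)
    qed
    moreover have "finite Q" using QD D_Vert finite_Vert finite_subset by metis
    ultimately obtain Z where "Z \<subseteq> Q" "Z \<noteq> {}" "f ` Z = Z"
      using finite_invariant_subset[of Q f] uQ by blast
    then show False using no_cycle QD by blast
  qed
qed

end

section \<open>The bijection\<close>

definition tail_arcs :: "vec3 \<Rightarrow> nat \<Rightarrow> (lozenge \<Rightarrow> vec3) \<Rightarrow> arc set" where
  "tail_arcs v t \<tau> = (\<Union>L\<in>{L \<in> Loz_in v t. \<tau> L \<noteq> dL L}. {(Pt (\<tau> L), Center L), (Center L, Pt (dL L))})"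

definition tails_of :: "vec3 \<Rightarrow> nat \<Rightarrow> rforest \<Rightarrow> (lozenge \<Rightarrow> vec3) \<Rightarrow> bool" where
  "tails_of v t R \<tau> \<longleftrightarrow>
     (\<forall>L\<in>Loz_in v t. \<forall>u. (\<exists>w. {u, w} \<in> diagonals L \<and> oriented v t R u w) \<longleftrightarrow> u = \<tau> L)"

lemma phi_tail_arcs:
  assumes "tails_of v t R \<tau>"
  shows "phi v t R = tail_arcs v t \<tau>"
proof -
  have "phi v t R = (\<Union>L\<in>Loz_in v t. \<Union>{{(Pt u, Center L), (Center L, Pt (dL L))} | u. u = \<tau> L \<and> u \<noteq> dL L})"
    unfolding phi_def
  proof (intro SUP_cong arg_cong[of _ _ Union])
    fix L assume L: "L \<in> Loz_in v t"
    have "\<And>u. (\<exists>w. {u, w} \<in> diagonals L \<and> oriented v t R u w) \<longleftrightarrow> u = \<tau> L"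
      using assms L unfolding tails_of_def by blast
    then show "{{(Pt u, Center L), (Center L, Pt (dL L))} | u w. {u, w} \<in> diagonals L \<and> oriented v t R u w \<and> u \<noteq> dL L}
        = {{(Pt u, Center L), (Center L, Pt (dL L))} | u. u = \<tau> L \<and> u \<noteq> dL L}"
      by blast
  qed simp
  then show ?thesis unfolding tail_arcs_def by blast
qed

lemma tail_arcs_iff [simp]:
  "(Pt u, Center L) \<in> tail_arcs v t \<tau> \<longleftrightarrow> L \<in> Loz_in v t \<and> \<tau> L \<noteq> dL L \<and> u = \<tau> L"
  "(Center L, Pt u) \<in> tail_arcs v t \<tau> \<longleftrightarrow> L \<in> Loz_in v t \<and> \<tau> L \<noteq> dL L \<and> u = dL L"
  "(Pt u, Pt w) \<notin> tail_arcs v t \<tau>"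
  "(Center L, Center M) \<notin> tail_arcs v t \<tau>"
  by (auto simp: tail_arcs_def)

lemma net_iff [simp]:
  "(Pt u, Center L) \<in> net v t \<longleftrightarrow> L \<in> Loz_in v t \<and> u \<in> {aL L, bL L, cL L}"
  "(Center L, Pt u) \<in> net v t \<longleftrightarrow> L \<in> Loz_in v t \<and> u = dL L"
  "(Pt u, Pt w) \<notin> net v t"
  "(Center L, Center M) \<notin> net v t"
  by (auto simp: net_def)

text \<open>A visited center shows its tail by the arc entering it, and an unvisited one has the
  tail \<open>dL L\<close>.\<close>

lemma tail_arcs_inject:
  assumes "tail_arcs v t \<tau> = tail_arcs v t \<tau>'" "L \<in> Loz_in v t"
  shows "\<tau> L = \<tau>' L"
proof (rule ccontr)
  assume neq: "\<tau> L \<noteq> \<tau>' L"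
  have "(Pt (\<tau> L), Center L) \<in> tail_arcs v t \<tau> \<longleftrightarrow> (Pt (\<tau> L), Center L) \<in> tail_arcs v t \<tau>'"
    "(Pt (\<tau>' L), Center L) \<in> tail_arcs v t \<tau> \<longleftrightarrow> (Pt (\<tau>' L), Center L) \<in> tail_arcs v t \<tau>'"
    using assms(1) by simp_all
  then show False using neq assms(2) by (simp only: tail_arcs_iff) metis
qed

section \<open>From rooted forests to tail assignments\<close>

context region
begin

lemma dL_inj: "L \<in> Loz_in v t \<Longrightarrow> M \<in> Loz_in v t \<Longrightarrow> dL L = dL M \<Longrightarrow> L = M"
  using lozD_dL Loz_in_lozenges by metis

lemma bL_inj: "L \<in> Loz_in v t \<Longrightarrow> M \<in> Loz_in v t \<Longrightarrow> bL L = bL M \<Longrightarrow> L = M"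
  using lozB_bL Loz_in_lozenges by metis

lemma dL_corner: "dL L \<in> corners L"
  by (simp add: corners_def)

lemma rooted_forestsD:
  assumes "R \<in> rooted_forests v t"
  shows "acyclic_graph (fst R)" and "E \<in> fst R \<Longrightarrow> \<exists>L\<in>Loz_in v t. E \<in> diagonals L"
    and "L \<in> Loz_in v t \<Longrightarrow> \<exists>!E. E \<in> diagonals L \<and> E \<in> fst R"
    and "C \<in> Defs.components (Vert v t) (fst R) \<Longrightarrow> snd R C \<in> C \<inter> boundary v t"
    and "snd R \<in> extensional (Defs.components (Vert v t) (fst R))"
proof -
  obtain F \<rho> where R: "R = (F, \<rho>)" by (cases R)
  have "F \<in> forests v t" and \<rho>: "\<rho> \<in> (\<Pi>\<^sub>E C\<in>Defs.components (Vert v t) F. C \<inter> boundary v t)"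
    using assms unfolding R rooted_forests_def by simp_all
  then have F: "F \<subseteq> (\<Union>L\<in>Loz_in v t. diagonals L)" "\<forall>L\<in>Loz_in v t. \<exists>!D. D \<in> diagonals L \<and> D \<in> F" "acyclic_graph F"
    unfolding forests_def by simp_all
  show "acyclic_graph (fst R)" and "E \<in> fst R \<Longrightarrow> \<exists>L\<in>Loz_in v t. E \<in> diagonals L"
    using F unfolding R fst_conv by blast+
  show "L \<in> Loz_in v t \<Longrightarrow> \<exists>!E. E \<in> diagonals L \<and> E \<in> fst R"
    using F(2) unfolding R fst_conv by (rule bspec)
  show "C \<in> Defs.components (Vert v t) (fst R) \<Longrightarrow> snd R C \<in> C \<inter> boundary v t"
    using \<rho> unfolding R fst_conv snd_conv by (rule PiE_mem)
  show "snd R \<in> extensional (Defs.components (Vert v t) (fst R))"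
    using \<rho> unfolding R fst_conv snd_conv PiE_def by blast
qed

lemma rooted_graph_forest:
  assumes R: "R \<in> rooted_forests v t"
  shows "rooted_graph (Vert v t) (fst R) (snd R)"
proof
  show "acyclic_graph (fst R)" by (rule rooted_forestsD[OF R])
  fix u w assume "{u, w} \<in> fst R"
  then obtain L where L: "L \<in> Loz_in v t" "{u, w} \<in> diagonals L"
    using rooted_forestsD(2)[OF R] by blast
  have u: "u \<in> corners L" "w = ctr L - u"
    using diagonal_corner[OF L(2)] diagonal_sum[OF L(2)] by (simp_all flip: diagonal_sum[OF L(2)])
  then show "u \<in> Vert v t \<and> u \<noteq> w"
    using corner_Vert[OF L(1)] opp_neq by metis
next
  show "snd R C \<in> C" if "C \<in> Defs.components (Vert v t) (fst R)" for C
    using rooted_forestsD(4)[OF R that] by blast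
qed

lemma oriented_ori:
  assumes R: "R \<in> rooted_forests v t"
  shows "oriented v t R u w \<longleftrightarrow> rooted_graph.ori (Vert v t) (fst R) (snd R) u w"
  using rooted_graph.ori_alt[OF rooted_graph_forest[OF R]] by (simp add: oriented_def)

text \<open>The one edge in a lozenge is oriented in exactly one way, which defines the tail. A
  vertex has at most one outgoing edge, which gives injectivity, and a vertex without one is a root
  and hence on the boundary.\<close>

lemma rooted_forest_tails:
  assumes R: "R \<in> rooted_forests v t"
  obtains \<tau> where "tail_assignment v t \<tau>" "tails_of v t R \<tau>"
proof -
  interpret rooted_graph "Vert v t" "fst R" "snd R" by (rule rooted_graph_forest[OF R])
  have ex1: "\<exists>!D. D \<in> diagonals L \<and> D \<in> fst R" if "L \<in> Loz_in v t" for L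
    using rooted_forestsD(3)[OF R that] .
  have cov: "\<exists>L\<in>Loz_in v t. D \<in> diagonals L" if "D \<in> fst R" for D
    using rooted_forestsD(2)[OF R that] .
  have bd: "snd R C \<in> boundary v t" if "C \<in> Defs.components (Vert v t) (fst R)" for C
    using rooted_forestsD(4)[OF R that] by blast
  define P where "P L u \<longleftrightarrow> (\<exists>w. {u, w} \<in> diagonals L \<and> ori u w)" for L u
  have P1: "\<exists>!u. P L u" if L: "L \<in> Loz_in v t" for L
  proof -
    obtain p q where pq: "{p, q} \<in> diagonals L" "{p, q} \<in> fst R"
      using ex1[OF L] unfolding diagonals_def by blast
    have "P L p \<or> P L q"
      using edge_ori[OF pq(2)] pq(1) insert_commute[of p q "{}"] unfolding P_def by metis
    then obtain u where u: "P L u" by blast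
    have "u' = u" if u': "P L u'" for u'
    proof -
      obtain w w' where w: "{u, w} \<in> diagonals L" "ori u w" "{u', w'} \<in> diagonals L" "ori u' w'"
        using u u' unfolding P_def by blast
      then have "{u, w} = {u', w'}" using ex1[OF L] ori_edge by blast
      then consider "u = u'" | "u = w'" "w = u'" unfolding doubleton_eq_iff by blast
      then show ?thesis using w(2,4) ori_asym by cases blast+
    qed
    then show ?thesis using u by blast
  qed
  define \<tau> where "\<tau> L = (THE u. P L u)" for L
  have \<tau>: "P L u \<longleftrightarrow> u = \<tau> L" if "L \<in> Loz_in v t" for L u
    using P1[OF that] theI'[OF P1[OF that]] unfolding \<tau>_def by blast
  have "tails_of v t R \<tau>"
    using \<tau> unfolding tails_of_def P_def oriented_ori[OF R] by blast
  moreover have "tail_assignment v t \<tau>"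
    unfolding tail_assignment_def
  proof (intro conjI ballI)
    fix L assume L: "L \<in> Loz_in v t"
    then show "\<tau> L \<in> corners L" using \<tau>[OF L, of "\<tau> L"] diagonal_corner unfolding P_def by blast
  next
    show "inj_on \<tau> (Loz_in v t)"
    proof (rule inj_onI)
      fix L M assume LM: "L \<in> Loz_in v t" "M \<in> Loz_in v t" "\<tau> L = \<tau> M"
      obtain w where w: "{\<tau> L, w} \<in> diagonals L" "ori (\<tau> L) w" using \<tau>[OF LM(1)] unfolding P_def by blast
      obtain w' where w': "{\<tau> L, w'} \<in> diagonals M" "ori (\<tau> L) w'" using \<tau>[OF LM(2)] LM(3) unfolding P_def by metis
      have "w = w'" using ori_unique w w' by blast
      then show "L = M" using diagonal_unique w w' by blast
    qed
    show "Vert v t - \<tau> ` Loz_in v t \<subseteq> boundary v t"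
    proof
      fix u assume u: "u \<in> Vert v t - \<tau> ` Loz_in v t"
      have "\<not> ori u w" for w
      proof
        assume "ori u w"
        then obtain L where "L \<in> Loz_in v t" "{u, w} \<in> diagonals L" using cov ori_edge by blast
        then have "u = \<tau> L" using \<tau>[of L u] \<open>ori u w\<close> unfolding P_def by blast
        then show False using u \<open>L \<in> Loz_in v t\<close> by blast
      qed
      then have "root u = u" using nonroot_ori u by blast
      then show "u \<in> boundary v t" using bd[OF conn_class_component[of u "Vert v t" "fst R"]] u
        unfolding root_def by simp
    qed
  qed
  ultimately show ?thesis using that by blast
qed

text \<open>The coordinate \<open>jc\<close> never decreases from a corner to \<open>dL L\<close>,
  and is equal only when the corner is green and \<open>dL L\<close> is not; the summand 2 breaks
  these ties. The factor 4 leaves room for the center just below \<open>dL L\<close>.\<close>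

definition pot :: "node \<Rightarrow> int" where
  "pot n = (case n of Pt u \<Rightarrow> 4 * jc u + (if color u = 1 then 0 else 2)
     | Center L \<Rightarrow> 4 * jc (dL L) + (if color (dL L) = 1 then 0 else 2) - 1)"

lemma net_pot:
  assumes "(n, n') \<in> net v t" shows "pot n < pot n'"
proof -
  have lt: "pot (Pt u) < pot (Center L)" if L: "L \<in> Loz_in v t" "u \<in> {aL L, bL L, cL L}" for L u
  proof -
    obtain r e where Lre: "L = Loz r e" by (cases L)
    have c: "color r = 0" using L(1) by (simp add: Loz_in_iff Lre)
    have "pot (Pt (aL L)) < pot (Center L) \<and> pot (Pt (bL L)) < pot (Center L) \<and> pot (Pt (cL L)) < pot (Center L)"
      unfolding Lre by (cases e) (simp_all add: pot_def c color_steps[OF c])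
    then show ?thesis using L(2) by blast
  qed
  show ?thesis
  proof (cases n)
    case (Pt u)
    then obtain L where "n' = Center L" using assms by (cases n') simp_all
    then show ?thesis using assms Pt lt by simp
  next
    case (Center L)
    then obtain u where "n' = Pt u" using assms by (cases n') simp_all
    then show ?thesis using assms Center by (simp add: pot_def)
  qed
qed

end

section \<open>From tail assignments to r-paths and rooted forests\<close>

context tails
begin

lemma D_iff: "u \<in> D \<longleftrightarrow> (\<exists>L\<in>Loz_in v t. \<tau> L = u)"
  by (auto simp: D_def)

lemma f_\<tau>: "L \<in> Loz_in v t \<Longrightarrow> f (\<tau> L) = ctr L - \<tau> L"
  by (simp add: f_def lz_\<tau>)

lemma \<tau>_inj: "L \<in> Loz_in v t \<Longrightarrow> M \<in> Loz_in v t \<Longrightarrow> \<tau> L = \<tau> M \<Longrightarrow> L = M"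
  using lz_\<tau> by metis

lemma tail_arcs_net: "tail_arcs v t \<tau> \<subseteq> net v t"
proof
  fix e assume "e \<in> tail_arcs v t \<tau>"
  then obtain L where L: "L \<in> Loz_in v t" "\<tau> L \<noteq> dL L" "e \<in> {(Pt (\<tau> L), Center L), (Center L, Pt (dL L))}"
    by (auto simp: tail_arcs_def)
  then show "e \<in> net v t" using \<tau>_corner[OF L(1)] by (auto simp: corners_def)
qed

lemma tail_arcs_rpaths: "tail_arcs v t \<tau> \<in> (\<Union>r. boundary_rpaths v t r)"
proof -
  let ?E = "tail_arcs v t \<tau>"
  have fin: "finite ?E" using finite_Loz_in by (auto simp: tail_arcs_def)
  have "\<exists>ps. ?E = (\<Union>p\<in>set ps. path_arcs p) \<and> disjoint_lists ps \<and>
    (\<forall>p\<in>set ps. 2 \<le> length p \<and> distinct p \<and> (\<forall>q. (q, hd p) \<notin> ?E) \<and> (\<forall>q. (last p, q) \<notin> ?E))"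
  proof (rule arc_set_decomposition[OF fin, where pot = pot])
    show "pot x < pot y" if "(x, y) \<in> ?E" for x y
      using that tail_arcs_net net_pot by blast
    show "y = z" if "(x, y) \<in> ?E" "(x, z) \<in> ?E" for x y z
      using that \<tau>_inj by (cases x; cases y; cases z) auto
    show "x = z" if "(x, y) \<in> ?E" "(z, y) \<in> ?E" for x y z
      using that dL_inj by (cases x; cases y; cases z) auto
  qed
  then obtain ps where ps: "?E = (\<Union>p\<in>set ps. path_arcs p)" "disjoint_lists ps"
    "\<And>p. p \<in> set ps \<Longrightarrow> 2 \<le> length p \<and> distinct p \<and> (\<forall>q. (q, hd p) \<notin> ?E) \<and> (\<forall>q. (last p, q) \<notin> ?E)"
    by blast
  have "boundary_path v t p" if p: "p \<in> set ps" for p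
  proof -
    have pE: "path_arcs p \<subseteq> ?E" using ps(1) p by blast
    have len: "2 \<le> length p" "distinct p" and hd: "\<And>q. (q, hd p) \<notin> ?E" and last: "\<And>q. (last p, q) \<notin> ?E"
      using ps(3)[OF p] by blast+
    have ne: "p \<noteq> []" "hd p \<noteq> last p" using len by (cases p; auto)+
    obtain y where y: "(hd p, y) \<in> ?E" using path_arcs_out[of p "hd p"] ne pE by auto
    obtain z where z: "(z, last p) \<in> ?E" using path_arcs_in[of p "last p"] ne pE by auto
    have "hd p \<in> Pt ` boundary v t \<and> (\<forall>q. (q, hd p) \<notin> net v t)"
    proof (cases "hd p")
      case (Pt u)
      then obtain L where L: "L \<in> Loz_in v t" "\<tau> L \<noteq> dL L" "u = \<tau> L" using y by (cases y) auto
      \<comment> \<open>If \<open>u\<close> is \<open>dL M\<close>, then, as nothing enters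
        \<open>u\<close>, the center of \<open>M\<close> is not visited and \<open>u\<close> is also
        the tail of \<open>M\<close>. Injectivity gives \<open>M = L\<close>, although the center of
        \<open>L\<close> is visited.\<close>
      have nod: "u \<noteq> dL M" if M: "M \<in> Loz_in v t" for M
      proof
        assume u: "u = dL M"
        then have "\<tau> M = dL M" using hd[of "Center M"] Pt M by auto
        then have "\<tau> M = \<tau> L" using u L(3) by simp
        then have "M = L" by (rule \<tau>_inj[OF M L(1)])
        then show False using L(2,3) u by simp
      qed
      have "u \<in> Vert v t" using L corner_Vert \<tau>_corner by blast
      then have "u \<in> boundary v t" using source_boundary nod by blast
      moreover have "(q, Pt u) \<notin> net v t" for q using nod by (cases q) auto
      ultimately show ?thesis using Pt by simp
    next
      case (Center L)
      then show ?thesis using y hd[of "Pt (\<tau> L)"] by (cases y) auto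
    qed
    moreover have "last p \<in> Pt ` boundary v t"
    proof (cases "last p")
      case (Pt u)
      then obtain L where L: "L \<in> Loz_in v t" "\<tau> L \<noteq> dL L" "u = dL L" using z by (cases z) auto
      \<comment> \<open>A tail without leaving arc belongs to an unvisited center, so
        \<open>u\<close> is \<open>dL M\<close> for it; as \<open>u\<close> is also
        \<open>dL L\<close>, this is \<open>L\<close>, whose center is visited.\<close>
      have "u \<notin> D"
      proof
        assume "u \<in> D"
        then obtain M where M: "M \<in> Loz_in v t" "\<tau> M = u" by (auto simp: D_iff)
        then have "\<tau> M = dL M" using last[of "Center M"] Pt by auto
        then have "dL M = dL L" using M(2) L(3) by metis
        then have "M = L" by (rule dL_inj[OF M(1) L(1)])
        then show False using L(2,3) M(2) by simp
      qed
      moreover have "u \<in> Vert v t" using L corner_Vert dL_corner by blast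
      ultimately show ?thesis using notin_D Pt by blast
    next
      case (Center L)
      then show ?thesis using z last[of "Pt (dL L)"] by (cases z) auto
    qed
    ultimately show ?thesis
      unfolding boundary_path_def using len pE tail_arcs_net by blast
  qed
  then have "?E \<in> boundary_rpaths v t (length ps)"
    unfolding boundary_rpaths_def mem_Collect_eq using ps(1) disjoint_lists_nth[THEN iffD1, OF ps(2)]
    by (intro exI[of _ ps]) simp
  then show ?thesis by blast
qed

lemma FE_\<tau>: "FE = (\<lambda>L. {\<tau> L, ctr L - \<tau> L}) ` Loz_in v t"
proof -
  have "FE = (\<lambda>u. {u, f u}) ` D" unfolding FE_def by blast
  also have "\<dots> = (\<lambda>u. {u, f u}) ` \<tau> ` Loz_in v t" by (simp only: D_def)
  also have "\<dots> = (\<lambda>L. {\<tau> L, f (\<tau> L)}) ` Loz_in v t" by (simp add: image_image)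
  also have "\<dots> = (\<lambda>L. {\<tau> L, ctr L - \<tau> L}) ` Loz_in v t" using f_\<tau> by (intro image_cong) auto
  finally show ?thesis .
qed

lemma tail_diagonal: "L \<in> Loz_in v t \<Longrightarrow> {\<tau> L, ctr L - \<tau> L} \<in> diagonals L"
  using corner_diagonal \<tau>_corner by blast

lemma FE_forest: "FE \<in> forests v t"
proof -
  have "\<exists>!E. E \<in> diagonals L \<and> E \<in> FE" if L: "L \<in> Loz_in v t" for L
  proof (rule ex1I[of _ "{\<tau> L, ctr L - \<tau> L}"])
    show "{\<tau> L, ctr L - \<tau> L} \<in> diagonals L \<and> {\<tau> L, ctr L - \<tau> L} \<in> FE"
      using tail_diagonal L unfolding FE_\<tau> by blast
    fix E assume E: "E \<in> diagonals L \<and> E \<in> FE"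
    then obtain M where M: "M \<in> Loz_in v t" "E = {\<tau> M, ctr M - \<tau> M}" unfolding FE_\<tau> by blast
    then have "M = L" using diagonal_unique tail_diagonal[OF M(1)] E by blast
    then show "E = {\<tau> L, ctr L - \<tau> L}" using M by simp
  qed
  moreover have "FE \<subseteq> (\<Union>L\<in>Loz_in v t. diagonals L)" using tail_diagonal unfolding FE_\<tau> by blast
  ultimately show ?thesis using acyclic_FE unfolding forests_def by blast
qed

lemma rchoice_rooted: "(FE, rchoice) \<in> rooted_forests v t"
proof -
  have "rchoice C \<in> C \<inter> boundary v t" if C: "C \<in> Defs.components (Vert v t) FE" for C
    using rchoice_in[OF C] component_eq(2)[OF C] notin_D by blast
  moreover have "rchoice \<in> extensional (Defs.components (Vert v t) FE)" by (simp add: rchoice_def)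
  ultimately show ?thesis using FE_forest unfolding rooted_forests_def by (simp add: PiE_iff)
qed

lemma rchoice_tails: "tails_of v t (FE, rchoice) \<tau>"
  unfolding tails_of_def
proof (intro ballI allI)
  fix L u assume L: "L \<in> Loz_in v t"
  have o: "oriented v t (FE, rchoice) u w \<longleftrightarrow> u \<in> D \<and> f u = w" for w
    unfolding oriented_def fst_conv snd_conv by (rule oriented_iff)
  show "(\<exists>w. {u, w} \<in> diagonals L \<and> oriented v t (FE, rchoice) u w) \<longleftrightarrow> u = \<tau> L"
  proof
    assume "\<exists>w. {u, w} \<in> diagonals L \<and> oriented v t (FE, rchoice) u w"
    then have u: "{u, f u} \<in> diagonals L" "u \<in> D" using o by auto
    then have "lz u = L" using diagonal_unique f(4) by blast
    then show "u = \<tau> L" using lz(2)[OF u(2)] by simp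
  next
    assume u: "u = \<tau> L"
    then have "u \<in> D" "{u, f u} \<in> diagonals L" using L tail_diagonal f_\<tau> by (auto simp: D_def)
    then show "\<exists>w. {u, w} \<in> diagonals L \<and> oriented v t (FE, rchoice) u w" using o by blast
  qed
qed

text \<open>The tails determine the diagonals, and the root of a component is not a tail, so it is
  the only vertex that \<open>rchoice\<close> can select.\<close>

lemma rooted_forest_eq:
  assumes R: "R \<in> rooted_forests v t" and \<tau>: "tails_of v t R \<tau>"
  shows "R = (FE, rchoice)"
proof -
  interpret r: rooted_graph "Vert v t" "fst R" "snd R" by (rule rooted_graph_forest[OF R])
  note o = oriented_ori[OF R]
  have t: "(\<exists>w. {u, w} \<in> diagonals L \<and> r.ori u w) \<longleftrightarrow> u = \<tau> L" if "L \<in> Loz_in v t" for L u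
    using \<tau> that unfolding tails_of_def o by blast
  have t': "r.ori (\<tau> L) (ctr L - \<tau> L)" if L: "L \<in> Loz_in v t" for L
  proof -
    obtain w where w: "{\<tau> L, w} \<in> diagonals L" "r.ori (\<tau> L) w" using t[OF L] by blast
    have "w = ctr L - \<tau> L" using diagonal_sum[OF w(1)] by (metis add_diff_cancel_left')
    then show ?thesis using w by simp
  qed
  have F: "fst R = FE"
  proof (intro equalityI subsetI)
    fix E assume E: "E \<in> fst R"
    then obtain L where L: "L \<in> Loz_in v t" "E \<in> diagonals L"
      using rooted_forestsD(2)[OF R] by blast
    then obtain p q where pq: "E = {p, q}" unfolding diagonals_def by blast
    have "E = {q, p}" using pq by (simp add: insert_commute)
    moreover have "r.ori p q \<or> r.ori q p" using r.edge_ori[of p q] E pq by simp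
    ultimately obtain u w where u: "E = {u, w}" "r.ori u w" using pq by blast
    then have "u = \<tau> L" using t[OF L(1)] L(2) by blast
    moreover have "w = ctr L - u" using diagonal_sum[of u w L] u L(2) by (metis add_diff_cancel_left')
    ultimately show "E \<in> FE" using u L(1) unfolding FE_\<tau> by blast
  next
    fix E assume "E \<in> FE"
    then obtain L where "L \<in> Loz_in v t" "E = {\<tau> L, ctr L - \<tau> L}" unfolding FE_\<tau> by blast
    then show "E \<in> fst R" using t' r.ori_edge by blast
  qed
  have eq: "snd R C = rchoice C" if C: "C \<in> Defs.components (Vert v t) FE" for C
  proof -
    have C': "C \<in> Defs.components (Vert v t) (fst R)" using C F by simp
    let ?s = "snd R C"
    have s: "?s \<in> C" using r.\<rho>[OF C'] .
    have sV: "?s \<in> Vert v t" using component_eq(2)[OF C' s] .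
    have "r.root ?s = ?s" unfolding r.root_def using component_eq(1)[OF C' s] by simp
    then have no: "\<not> r.ori ?s w" for w using r.root_not_ori[OF sV] by blast
    have "?s \<notin> D"
    proof
      assume "?s \<in> D"
      then obtain L where L: "L \<in> Loz_in v t" "\<tau> L = ?s" by (auto simp: D_iff)
      then show False using t'[OF L(1)] no by simp
    qed
    then show ?thesis using rchoice_eq[OF C s] rt_root by simp
  qed
  have "snd R = rchoice"
  proof (rule extensionalityI)
    show "snd R \<in> extensional (Defs.components (Vert v t) FE)" using rooted_forestsD(5)[OF R] F by simp
    show "rchoice \<in> extensional (Defs.components (Vert v t) FE)" by (simp add: rchoice_def)
  qed (rule eq)
  then show ?thesis using F by (simp add: prod_eq_iff)
qed

end

text \<open>Extracts from the global description by paths the local properties of the arc set from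
  which its tail assignment is built; the last one keeps the requirement that paths start at
  sources.\<close>

lemma rpaths_local:
  assumes "E \<in> boundary_rpaths v t r"
  shows "E \<subseteq> net v t"
    and "\<And>x y z. (x, y) \<in> E \<Longrightarrow> (x, z) \<in> E \<Longrightarrow> y = z"
    and "\<And>x y z. (x, y) \<in> E \<Longrightarrow> (z, y) \<in> E \<Longrightarrow> x = z"
    and "\<And>x y. (x, y) \<in> E \<Longrightarrow> (\<exists>z. (y, z) \<in> E) \<or> y \<in> Pt ` boundary v t"
    and "\<And>x y. (x, y) \<in> E \<Longrightarrow> (\<exists>z. (z, x) \<in> E) \<or> x \<in> Pt ` boundary v t \<and> (\<forall>q. (q, x) \<notin> net v t)"
proof -
  obtain ps where ps: "E = (\<Union>p\<in>set ps. path_arcs p)" "\<And>p. p \<in> set ps \<Longrightarrow> boundary_path v t p"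
    and dis: "disjoint_lists ps"
    using assms unfolding boundary_rpaths_def disjoint_lists_nth by blast
  have get: "\<exists>p\<in>set ps. (x, y) \<in> path_arcs p \<and> x \<in> set p \<and> y \<in> set p \<and> p \<noteq> []" if xy: "(x, y) \<in> E" for x y
  proof -
    obtain p where p: "p \<in> set ps" "(x, y) \<in> path_arcs p" using ps(1) xy by blast
    then have "p \<noteq> []" using path_arcs_set[of x y p] by auto
    then show ?thesis using p path_arcs_set[of x y p] list.set_sel(2)[of p y] by blast
  qed
  have d: "distinct p" if "p \<in> set ps" for p using ps(2)[OF that] by (simp add: boundary_path_def)
  show "E \<subseteq> net v t" using ps by (auto simp: boundary_path_def)
  show "y = z" if xy: "(x, y) \<in> E" "(x, z) \<in> E" for x y z
  proof -
    obtain p q where pq: "p \<in> set ps" "(x, y) \<in> path_arcs p" "x \<in> set p" "q \<in> set ps" "(x, z) \<in> path_arcs q" "x \<in> set q"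
      using get[OF xy(1)] get[OF xy(2)] by blast
    then have "p = q" using disjoint_lists_unique[OF dis] by blast
    then show ?thesis using pq path_arcs_out_unique d by blast
  qed
  show "x = z" if xy: "(x, y) \<in> E" "(z, y) \<in> E" for x y z
  proof -
    obtain p q where pq: "p \<in> set ps" "(x, y) \<in> path_arcs p" "y \<in> set p" "q \<in> set ps" "(z, y) \<in> path_arcs q" "y \<in> set q"
      using get[OF xy(1)] get[OF xy(2)] by blast
    then have "p = q" using disjoint_lists_unique[OF dis] by blast
    then show ?thesis using pq path_arcs_in_unique d by blast
  qed
  show "(\<exists>z. (y, z) \<in> E) \<or> y \<in> Pt ` boundary v t" if xy: "(x, y) \<in> E" for x y
  proof -
    obtain p where p: "p \<in> set ps" "y \<in> set p" "p \<noteq> []" using get[OF xy] by blast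
    then show ?thesis using path_arcs_out[of p y] ps(1) ps(2)[OF p(1)] unfolding boundary_path_def by blast
  qed
  show "(\<exists>z. (z, x) \<in> E) \<or> x \<in> Pt ` boundary v t \<and> (\<forall>q. (q, x) \<notin> net v t)" if xy: "(x, y) \<in> E" for x y
  proof -
    obtain p where p: "p \<in> set ps" "x \<in> set p" "p \<noteq> []" using get[OF xy] by blast
    then show ?thesis using path_arcs_in[of p x] ps(1) ps(2)[OF p(1)] unfolding boundary_path_def by blast
  qed
qed

context region
begin

lemma rpaths_tails:
  assumes "E \<in> boundary_rpaths v t r"
  obtains \<tau> where "tail_assignment v t \<tau>" "E = tail_arcs v t \<tau>"
proof -
  note loc = rpaths_local[OF assms]
  define used where "used L \<longleftrightarrow> (\<exists>u. (Pt u, Center L) \<in> E)" for L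
  \<comment> \<open>At an unvisited center the default \<open>dL L\<close> is the tail for which
    \<open>phi\<close> takes no arcs.\<close>
  define \<tau> where "\<tau> L = (if used L then THE u. (Pt u, Center L) \<in> E else dL L)" for L
  have Loz: "L \<in> Loz_in v t \<and> u \<in> {aL L, bL L, cL L}" if "(Pt u, Center L) \<in> E" for u L
    using that loc(1) net_iff(1) by blast
  have \<tau>_used: "\<tau> L = u" if "(Pt u, Center L) \<in> E" for u L
  proof -
    have "(THE u. (Pt u, Center L) \<in> E) = u"
    proof (rule the_equality)
      show "(Pt u, Center L) \<in> E" by (rule that)
      show "w = u" if "(Pt w, Center L) \<in> E" for w using loc(3)[OF that \<open>(Pt u, Center L) \<in> E\<close>] by simp
    qed
    moreover have "used L" using that unfolding used_def by blast
    ultimately show ?thesis by (simp only: \<tau>_def if_True)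
  qed
  have \<tau>_ne: "\<tau> L \<noteq> dL L" if L: "used L" for L
  proof -
    obtain u where "(Pt u, Center L) \<in> E" using L used_def by blast
    then show ?thesis using \<tau>_used Loz corners_neq[of L] by fastforce
  qed
  have used_iff: "\<tau> L \<noteq> dL L \<longleftrightarrow> used L" for L
    using \<tau>_ne by (auto simp: \<tau>_def)
  have arc_in: "(Pt (\<tau> L), Center L) \<in> E" if "used L" for L
    using that \<tau>_used unfolding used_def by blast
  have used_Loz: "L \<in> Loz_in v t" if "used L" for L
    using that Loz unfolding used_def by blast
  have arc_out: "(Center L, Pt (dL L)) \<in> E" if L: "used L" for L
  proof -
    obtain z where z: "(Center L, z) \<in> E" using loc(4)[OF arc_in[OF L]] by blast
    then have "(Center L, z) \<in> net v t" using loc(1) by blast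
    then show ?thesis using z by (cases z) auto
  qed
  have out_used: "used L \<and> y = Pt (dL L)" if Ly: "(Center L, y) \<in> E" for L y
  proof -
    obtain z where z: "(z, Center L) \<in> E" using loc(5)[OF Ly] by blast
    then have "(z, Center L) \<in> net v t" "(Center L, y) \<in> net v t" using loc(1) Ly by auto
    then show ?thesis using z by (cases z; cases y) (auto simp: used_def)
  qed
  have E: "(x, y) \<in> E \<longleftrightarrow> (x, y) \<in> tail_arcs v t \<tau>" for x y
  proof (cases x)
    case (Pt u)
    show ?thesis
    proof (cases y)
      case (Pt w)
      then show ?thesis using \<open>x = Pt u\<close> loc(1) by auto
    next
      case (Center L)
      then show ?thesis using \<open>x = Pt u\<close> \<tau>_used arc_in used_Loz used_iff used_def by (simp only: tail_arcs_iff) metis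
    qed
  next
    case (Center L)
    show ?thesis
    proof (cases y)
      case (Pt w)
      then show ?thesis using \<open>x = Center L\<close> out_used arc_out used_Loz used_iff by (simp only: tail_arcs_iff) blast
    next
      case (Center M)
      then show ?thesis using \<open>x = Center L\<close> loc(1) by auto
    qed
  qed
  have in_arc: "\<exists>M. q = Center M \<and> used M \<and> u = dL M" if "(q, Pt u) \<in> E" for q u
  proof -
    have "(q, Pt u) \<in> net v t" using that loc(1) by blast
    then obtain M where "q = Center M" by (cases q) auto
    then show ?thesis using out_used that by blast
  qed
  \<comment> \<open>Here it matters that paths start at sources: \<open>dL M\<close> is entered by
    an arc of the network, so a path leaving it must have arrived there, which is possible only
    through the center of \<open>M\<close>.\<close>
  have used_unused: False if L: "L \<in> Loz_in v t" "M \<in> Loz_in v t" "used L" "\<not> used M" "\<tau> L = \<tau> M" for L M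
  proof -
    have u: "\<tau> L = dL M" using L used_iff by auto
    have "(Pt (dL M), Center L) \<in> E" using arc_in[OF L(3)] u by simp
    then have "(\<exists>q. (q, Pt (dL M)) \<in> E) \<or> (\<forall>q. (q, Pt (dL M)) \<notin> net v t)" using loc(5) by blast
    moreover have "(Center M, Pt (dL M)) \<in> net v t" using L(2) by simp
    ultimately obtain N where "used N" "dL M = dL N" using in_arc by blast
    then show False using dL_inj[OF L(2) used_Loz] L(4) by auto
  qed
  have "tail_assignment v t \<tau>"
    unfolding tail_assignment_def
  proof (intro conjI ballI)
    show "\<tau> L \<in> corners L" if "L \<in> Loz_in v t" for L
    proof (cases "used L")
      case True
      then show ?thesis using Loz[OF arc_in[OF True]] by (auto simp: corners_def)
    next
      case False
      then show ?thesis using used_iff[of L] dL_corner by simp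
    qed
    show "inj_on \<tau> (Loz_in v t)"
    proof (rule inj_onI)
      fix L M assume LM: "L \<in> Loz_in v t" "M \<in> Loz_in v t" "\<tau> L = \<tau> M"
      consider "used L" "used M" | "\<not> used L" "\<not> used M"
        using used_unused[OF LM(1,2)] used_unused[OF LM(2,1)] LM(3) by metis
      then show "L = M"
      proof cases
        case 1
        then show ?thesis using loc(2)[OF arc_in arc_in[of M, folded LM(3)]] by simp
      next
        case 2
        then show ?thesis using LM dL_inj used_iff by metis
      qed
    qed
    show "Vert v t - \<tau> ` Loz_in v t \<subseteq> boundary v t"
    proof
      fix u assume u: "u \<in> Vert v t - \<tau> ` Loz_in v t"
      show "u \<in> boundary v t"
      proof (cases "\<exists>q. (q, Pt u) \<in> E")
        case True
        moreover have "(Pt u, z) \<notin> E" for z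
        proof
          assume z: "(Pt u, z) \<in> E"
          then have "(Pt u, z) \<in> net v t" using loc(1) by blast
          then obtain L where "z = Center L" by (cases z) auto
          then show False using z u Loz \<tau>_used by blast
        qed
        ultimately show ?thesis using loc(4) by blast
      next
        case False
        have "u \<noteq> dL M" if "M \<in> Loz_in v t" for M
        proof
          assume "u = dL M"
          then have "\<not> used M" using False arc_out by blast
          then show False using u that used_iff[of M] \<open>u = dL M\<close> by force
        qed
        then show ?thesis using source_boundary u by blast
      qed
    qed
  qed
  moreover have "E = tail_arcs v t \<tau>" using E by (intro set_eqI) (metis surj_pair)
  ultimately show ?thesis using that by blast
qed

lemma region_tails: "tail_assignment v t \<tau> \<Longrightarrow> tails v t \<tau>"
  by unfold_locales

lemma phi_bij: "bij_betw (phi v t) (rooted_forests v t) (\<Union>r. boundary_rpaths v t r)"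
  unfolding bij_betw_def
proof (intro conjI equalityI subsetI)
  show "inj_on (phi v t) (rooted_forests v t)"
  proof (rule inj_onI)
    fix R R' assume R: "R \<in> rooted_forests v t" "R' \<in> rooted_forests v t" "phi v t R = phi v t R'"
    obtain \<tau> where \<tau>: "tail_assignment v t \<tau>" "tails_of v t R \<tau>" using rooted_forest_tails[OF R(1)] .
    obtain \<tau>' where \<tau>': "tail_assignment v t \<tau>'" "tails_of v t R' \<tau>'" using rooted_forest_tails[OF R(2)] .
    have "tail_arcs v t \<tau> = tail_arcs v t \<tau>'" using phi_tail_arcs[OF \<tau>(2)] phi_tail_arcs[OF \<tau>'(2)] R(3) by simp
    then have "\<And>L. L \<in> Loz_in v t \<Longrightarrow> \<tau> L = \<tau>' L" by (rule tail_arcs_inject)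
    then have "tails_of v t R' \<tau>" using \<tau>'(2) unfolding tails_of_def by simp
    interpret tails v t \<tau> by (rule region_tails[OF \<tau>(1)])
    show "R = R'" using rooted_forest_eq[OF R(1) \<tau>(2)] rooted_forest_eq[OF R(2) \<open>tails_of v t R' \<tau>\<close>] by simp
  qed
next
  fix E assume "E \<in> phi v t ` rooted_forests v t"
  then obtain R where R: "R \<in> rooted_forests v t" "E = phi v t R" by blast
  obtain \<tau> where \<tau>: "tail_assignment v t \<tau>" "tails_of v t R \<tau>" using rooted_forest_tails[OF R(1)] .
  then show "E \<in> (\<Union>r. boundary_rpaths v t r)"
    using R(2) phi_tail_arcs tails.tail_arcs_rpaths[OF region_tails] by metis
next
  fix E assume "E \<in> (\<Union>r. boundary_rpaths v t r)"
  then obtain r where "E \<in> boundary_rpaths v t r" by blast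
  then obtain \<tau> where \<tau>: "tail_assignment v t \<tau>" "E = tail_arcs v t \<tau>" by (rule rpaths_tails)
  interpret tails v t \<tau> by (rule region_tails[OF \<tau>(1)])
  show "E \<in> phi v t ` rooted_forests v t"
    using rchoice_rooted phi_tail_arcs[OF rchoice_tails] \<tau>(2) by (intro image_eqI[of _ _ "(FE, rchoice)"]) auto
qed

end

section \<open>Weights\<close>

context region
begin

section \<open>Exponents left over along the first side\<close>

lemma bda_inj: "inj_on (\<lambda>i. bda v t (2 * i + 1)) A" "inj_on (\<lambda>i. bda v t (2 * i)) A"
  by (cases v; auto simp: inj_on_def bda_def Let_def)+

lemma bd_corners:
  assumes "u \<in> P0"
  shows "u = bda v t 1 \<longleftrightarrow> hA u = int t - 1 \<and> hC u = int t - 1"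
    "u = bdb v t 1 \<longleftrightarrow> hA u = int t - 1 \<and> hB u = int t - 1"
    "u = bdc v t 1 \<longleftrightarrow> hB u = int t - 1 \<and> hC u = int t - 1"
proof -
  obtain i j k x y z where u: "u = (i, j, k)" and v: "v = (x, y, z)" by (metis prod_cases3)
  have s: "k = - i - j" "z = - x - y" using assms vP0 by (auto simp: u v P0_def)
  show "u = bda v t 1 \<longleftrightarrow> hA u = int t - 1 \<and> hC u = int t - 1"
    "u = bdb v t 1 \<longleftrightarrow> hA u = int t - 1 \<and> hB u = int t - 1"
    "u = bdc v t 1 \<longleftrightarrow> hB u = int t - 1 \<and> hC u = int t - 1"
    unfolding hA_def hB_def hC_def by (auto simp: u v s bda_def bdb_def bdc_def Let_def) (smt (verit))+
qed

definition Aodd :: "vec3 set" where "Aodd = (\<lambda>i. bda v t (2 * i + 1)) ` {0..t - 1}"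
definition Aeven :: "vec3 set" where "Aeven = (\<lambda>i. bda v t (2 * i)) ` {1..t - 1}"

lemma Aodd_iff: "u \<in> Aodd \<longleftrightarrow> u \<in> P0 \<and> hA u = int t - 1 \<and> hB u < int t \<and> hC u < int t"
  unfolding Aodd_def image_iff by (rule bd_odd)

lemma Aeven_iff: "u \<in> Aeven \<longleftrightarrow> u \<in> P0 \<and> hA u = int t \<and> hB u < int t \<and> hC u < int t"
  unfolding Aeven_def image_iff by (rule bd_even)

lemma W_sets: "W x v t = (\<Prod>u\<in>Aodd. x u) / (\<Prod>u\<in>Aeven. x u)"
  unfolding W_def Aodd_def Aeven_def by (simp only: prod.reindex[OF bda_inj(1)] prod.reindex[OF bda_inj(2)] comp_def)

lemma color_on_A:
  assumes "u \<in> P0"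
  shows "hA u = int t - 1 \<Longrightarrow> color u = 2" "hA u = int t \<Longrightarrow> color u = 1"
proof -
  have "0 \<le> color u" "color u < 3" unfolding color_crdB by simp_all
  then show "hA u = int t - 1 \<Longrightarrow> color u = 2" "hA u = int t \<Longrightarrow> color u = 1"
    by - (rule residues[OF assms]; presburger)+
qed

lemma A_Vert: "Aodd \<subseteq> Vert v t" "Aeven \<subseteq> Vert v t"
proof -
  have V: "u \<in> Vert v t" if "red L \<in> P0" "color (red L) = 0" "inside (red L)" "u \<in> corners L" for u L
    using that corner_Vert Loz_in_iff by blast
  show "Aodd \<subseteq> Vert v t"
  proof
    fix u assume u: "u \<in> Aodd"
    then have P: "u \<in> P0" "hA u = int t - 1" "hB u < int t" "hC u < int t" by (simp_all add: Aodd_iff)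
    have c: "color u = 2" using color_on_A P by blast
    have cr: "color (u - e12) = 0" "color (u - e23) = 0" using c unfolding color_crdB by (simp; presburger)+
    show "u \<in> Vert v t"
    \<comment> \<open>The vertex where the sides A and B meet needs another lozenge: there
      \<open>u - e23\<close> lies beyond side B, while \<open>t \<ge> 2\<close> keeps
      \<open>u - e12\<close> inside.\<close>
    proof (cases "hB u = int t - 1")
      case True
      then show ?thesis using P c cr t2 hC_eq[of u]
        by (intro V[of "Loz (u - e12) D12"]) (simp_all add: inside_def corners_def)
    next
      case False
      then have "hB u \<le> int t - 4" using blue_less(2)[OF P(1) c] P(3) by linarith
      then show ?thesis using P c cr t2 hC_eq[of u]
        by (intro V[of "Loz (u - e23) D23"]) (simp_all add: inside_def corners_def)
    qed
  qed
  show "Aeven \<subseteq> Vert v t"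
  proof
    fix u assume u: "u \<in> Aeven"
    then have P: "u \<in> P0" "hA u = int t" "hB u < int t" "hC u < int t" by (simp_all add: Aeven_iff)
    have c: "color u = 1" using color_on_A P by blast
    have cr: "color (u + e31) = 0" using c unfolding color_crdB by (simp; presburger)
    show "u \<in> Vert v t" using P cr green_less[OF P(1) c]
      by (intro V[of "Loz (u + e31) D12"]) (simp_all add: inside_def corners_def)
  qed
qed

text \<open>The left side is the exponent of \<open>x u\<close> that remains when the weight of the
  paths is split off. Away from side A the value of \<open>s_exp\<close> equals the number of the
  two lozenges of \<open>u\<close> that are missing from the region. On side A a green vertex lacks
  both but has \<open>s_exp\<close> equal to 1, and at a blue vertex \<open>s_exp\<close> exceeds
  the number of missing lozenges by 1; this leaves \<open>W\<close>.\<close>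

lemma exponent:
  assumes u: "u \<in> Vert v t"
  shows "of_bool (u \<in> bL ` Loz_in v t) + of_bool (u \<in> dL ` Loz_in v t) - 2 + s_exp v t u
    = of_bool (u \<in> Aodd) - (of_bool (u \<in> Aeven) :: int)"
proof -
  have P: "u \<in> P0" "inside u" using Vert_inside[OF u] by auto
  have in': "hA u \<le> int t" "hB u \<le> int t" "hC u \<le> int t" using P(2) by (simp_all add: inside_def)
  note simps = bL_image[OF u] dL_image[OF u] s_exp_def boundary_iff[OF u] Aodd_iff Aeven_iff
    insert_iff bd_corners[OF P(1)]
  show ?thesis
  proof (cases u rule: color_cases)
    case red
    then show ?thesis using P inside_red[OF P(1) red] unfolding simps by simp
  next
    case green
    then have no: "hA u \<noteq> int t - 1" "hB u \<noteq> int t - 1" "hC u \<noteq> int t - 1"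
      using green_less[OF P(1) green] by linarith+
    show ?thesis unfolding simps using green P(1) no in' Vert_green[OF u green]
      by (cases "hA u = int t"; cases "hB u = int t"; cases "hC u = int t") simp_all
  next
    case blue
    have le: "hA u \<le> int t - 1" "hB u \<le> int t - 1" "hC u \<le> int t - 1"
      using P(2) inside_blue[OF P(1) blue] by simp_all
    have "\<not> (hA u = int t - 1 \<and> hB u = int t - 1 \<and> hC u = int t - 1)" using hC_eq[of u] t2 by linarith
    then show ?thesis unfolding simps using blue P(1) le
      by (cases "hA u = int t - 1"; cases "hB u = int t - 1"; cases "hC u = int t - 1") simp_all
  qed
qed

end

lemma prod_of_bool_subset:
  fixes x :: "'b \<Rightarrow> 'a::comm_monoid_mult"
  assumes "finite V" "S \<subseteq> V"
  shows "(\<Prod>u\<in>V. x u ^ of_bool (u \<in> S)) = (\<Prod>u\<in>S. x u)"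
proof -
  have "(\<Prod>u\<in>S. x u) = (\<Prod>u\<in>S. x u ^ of_bool (u \<in> S))" by (intro prod.cong) auto
  also have "\<dots> = (\<Prod>u\<in>V. x u ^ of_bool (u \<in> S))" using assms by (intro prod.mono_neutral_left) auto
  finally show ?thesis ..
qed

section \<open>Weights computed lozenge by lozenge\<close>

context tails
begin

lemma degree_FE: "degree FE u = (\<Sum>L\<in>Loz_in v t. of_bool (u \<in> {\<tau> L, ctr L - \<tau> L}))"
proof -
  have inj: "inj_on (\<lambda>L. {\<tau> L, ctr L - \<tau> L}) (Loz_in v t)"
  proof (rule inj_onI)
    fix L M assume LM: "L \<in> Loz_in v t" "M \<in> Loz_in v t" "{\<tau> L, ctr L - \<tau> L} = {\<tau> M, ctr M - \<tau> M}"
    then show "L = M" using tail_diagonal[OF LM(1)] tail_diagonal[OF LM(2)] diagonal_unique by simp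
  qed
  have "degree FE u = card ((\<lambda>L. {\<tau> L, ctr L - \<tau> L}) ` {L \<in> Loz_in v t. u \<in> {\<tau> L, ctr L - \<tau> L}})"
    unfolding degree_def FE_\<tau> by (intro arg_cong[of _ _ card]) blast
  also have "\<dots> = card {L \<in> Loz_in v t. u \<in> {\<tau> L, ctr L - \<tau> L}}"
    by (intro card_image inj_on_subset[OF inj]) blast
  also have "\<dots> = (\<Sum>L\<in>Loz_in v t. of_bool (u \<in> {\<tau> L, ctr L - \<tau> L}))"
    using finite_Loz_in by (simp add: of_bool_def sum.If_cases Int_def)
  finally show ?thesis .
qed

text \<open>Double counting of incidences: each lozenge contributes the two ends of its one
  edge.\<close>

lemma prod_degree:
  fixes x :: "vec3 \<Rightarrow> 'a::field"
  shows "(\<Prod>u\<in>Vert v t. x u ^ degree FE u) = (\<Prod>L\<in>Loz_in v t. x (\<tau> L) * x (ctr L - \<tau> L))"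
proof -
  have "(\<Prod>u\<in>Vert v t. x u ^ degree FE u) =
      (\<Prod>u\<in>Vert v t. \<Prod>L\<in>Loz_in v t. x u ^ of_bool (u \<in> {\<tau> L, ctr L - \<tau> L}))"
    unfolding degree_FE power_sum ..
  also have "\<dots> = (\<Prod>L\<in>Loz_in v t. \<Prod>u\<in>Vert v t. x u ^ of_bool (u \<in> {\<tau> L, ctr L - \<tau> L}))"
    by (rule prod.swap)
  also have "\<dots> = (\<Prod>L\<in>Loz_in v t. x (\<tau> L) * x (ctr L - \<tau> L))"
  proof (rule prod.cong[OF refl])
    fix L assume L: "L \<in> Loz_in v t"
    have "{\<tau> L, ctr L - \<tau> L} \<subseteq> Vert v t"
      using corner_Vert[OF L] \<tau>_corner[OF L] opp_corner by blast
    then have "(\<Prod>u\<in>Vert v t. x u ^ of_bool (u \<in> {\<tau> L, ctr L - \<tau> L})) = (\<Prod>u\<in>{\<tau> L, ctr L - \<tau> L}. x u)"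
      by (rule prod_of_bool_subset[OF finite_Vert])
    also have "\<dots> = x (\<tau> L) * x (ctr L - \<tau> L)"
      using opp_neq[OF \<tau>_corner[OF L]] by (subst prod.insert) (auto simp: eq_commute)
    finally show "(\<Prod>u\<in>Vert v t. x u ^ of_bool (u \<in> {\<tau> L, ctr L - \<tau> L})) = x (\<tau> L) * x (ctr L - \<tau> L)" .
  qed
  finally show ?thesis .
qed

lemma wt_tail_arcs:
  fixes x :: "vec3 \<Rightarrow> 'a::field"
  shows "wt_arcs x (tail_arcs v t \<tau>) = (\<Prod>L\<in>Loz_in v t. if \<tau> L \<in> {aL L, cL L} then alpha x L else 1)"
proof -
  let ?S = "{L \<in> Loz_in v t. \<tau> L \<noteq> dL L}"
  have "wt_arcs x (tail_arcs v t \<tau>) = (\<Prod>L\<in>?S. \<Prod>e\<in>{(Pt (\<tau> L), Center L), (Center L, Pt (dL L))}. arc_wt x e)"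
    unfolding wt_arcs_def tail_arcs_def using finite_Loz_in by (intro prod.UNION_disjoint) auto
  also have "\<dots> = (\<Prod>L\<in>?S. if \<tau> L \<in> {aL L, cL L} then alpha x L else 1)"
    by (intro prod.cong) auto
  also have "\<dots> = (\<Prod>L\<in>Loz_in v t. if \<tau> L \<in> {aL L, cL L} then alpha x L else 1)"
  proof (rule prod.mono_neutral_left[OF finite_Loz_in])
    show "\<forall>L\<in>Loz_in v t - ?S. (if \<tau> L \<in> {aL L, cL L} then alpha x L else 1) = 1"
    proof
      fix L assume "L \<in> Loz_in v t - ?S"
      then have "\<tau> L = dL L" by blast
      then show "(if \<tau> L \<in> {aL L, cL L} then alpha x L else 1) = 1"
        using corners_neq[of L] by (metis insertE singletonD)
    qed
  qed blast
  finally show ?thesis .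
qed

text \<open>\<open>alpha x L\<close> is the ratio of the monomials of the two diagonals. Hence the
  arc weight is exactly the price for using the diagonal of \<open>aL L\<close> and
  \<open>cL L\<close>, and the remaining factor does not depend on the forest.\<close>

lemma diagonal_weight:
  fixes x :: "vec3 \<Rightarrow> 'a::field"
  assumes "L \<in> Loz_in v t" "x (bL L) \<noteq> 0" "x (dL L) \<noteq> 0"
  shows "x (\<tau> L) * x (ctr L - \<tau> L) = (if \<tau> L \<in> {aL L, cL L} then alpha x L else 1) * (x (bL L) * x (dL L))"
proof -
  consider "\<tau> L = aL L" | "\<tau> L = bL L" | "\<tau> L = cL L" | "\<tau> L = dL L"
    using \<tau>_corner[OF assms(1)] by (rule corner_cases)
  then show ?thesis
  proof cases
    case 2
    then have "\<tau> L \<notin> {aL L, cL L}" using corners_neq[of L] by (metis insertE singletonD)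
    then show ?thesis using 2 by (simp add: ctr_minus)
  next
    case 4
    then have "\<tau> L \<notin> {aL L, cL L}" using corners_neq[of L] by (metis insertE singletonD)
    then show ?thesis using 4 by (simp add: ctr_minus mult.commute)
  qed (use assms in \<open>simp_all add: ctr_minus alpha_def\<close>)
qed

lemma wt_forest_FE:
  fixes x :: "vec3 \<Rightarrow> 'a::field"
  assumes x: "\<And>u. u \<in> P0 \<Longrightarrow> x u \<noteq> 0"
  shows "wt_forest x v t FE = wt_arcs x (tail_arcs v t \<tau>) * W x v t"
proof -
  let ?V = "Vert v t" and ?L = "Loz_in v t"
  have nz: "x u \<noteq> 0" if "u \<in> ?V" for u using x Vert_inside[OF that] by blast
  have nzL: "x (bL L) \<noteq> 0" "x (dL L) \<noteq> 0" if "L \<in> ?L" for L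
    using nz corner_Vert[OF that] by (simp_all add: corners_def)
  have img: "bL ` ?L \<subseteq> ?V" "dL ` ?L \<subseteq> ?V" using corner_Vert by (auto simp: corners_def)
  have inj: "inj_on bL ?L" "inj_on dL ?L" by (simp_all add: inj_on_def bL_inj dL_inj)
  have "(\<Prod>u\<in>?V. x u ^ degree FE u) = (\<Prod>L\<in>?L. (if \<tau> L \<in> {aL L, cL L} then alpha x L else 1) * (x (bL L) * x (dL L)))"
    unfolding prod_degree by (intro prod.cong[OF refl] diagonal_weight nzL)
  also have "\<dots> = wt_arcs x (tail_arcs v t \<tau>) * ((\<Prod>L\<in>?L. x (bL L)) * (\<Prod>L\<in>?L. x (dL L)))"
    unfolding wt_tail_arcs prod.distrib ..
  also have "(\<Prod>L\<in>?L. x (bL L)) = (\<Prod>u\<in>?V. x u ^ of_bool (u \<in> bL ` ?L))"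
    unfolding prod_of_bool_subset[OF finite_Vert img(1)] using prod.reindex[OF inj(1), of x] by simp
  also have "(\<Prod>L\<in>?L. x (dL L)) = (\<Prod>u\<in>?V. x u ^ of_bool (u \<in> dL ` ?L))"
    unfolding prod_of_bool_subset[OF finite_Vert img(2)] using prod.reindex[OF inj(2), of x] by simp
  finally have deg: "(\<Prod>u\<in>?V. x u ^ degree FE u) = wt_arcs x (tail_arcs v t \<tau>) *
      ((\<Prod>u\<in>?V. x u ^ of_bool (u \<in> bL ` ?L)) * (\<Prod>u\<in>?V. x u ^ of_bool (u \<in> dL ` ?L)))" .
  \<comment> \<open>The exponent \<open>s - 2\<close> can be negative, so separating it from the
    degree uses that \<open>x u\<close> is nonzero.\<close>
  have split: "x u powi (int n - 2 + s) = x u ^ n * x u powi (s - 2)" if "u \<in> ?V" for u n s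
  proof -
    have "int n - 2 + s = int n + (s - 2)" by simp
    then show ?thesis using nz[OF that] by (simp only: power_int_add) (simp add: power_int_add)
  qed
  have "wt_forest x v t FE = (\<Prod>u\<in>?V. x u ^ degree FE u) * (\<Prod>u\<in>?V. x u powi (s_exp v t u - 2))"
    unfolding wt_forest_def prod.distrib[symmetric] using split by (intro prod.cong) auto
  also have "\<dots> = wt_arcs x (tail_arcs v t \<tau>) * (\<Prod>u\<in>?V. x u ^ of_bool (u \<in> bL ` ?L) *
      x u ^ of_bool (u \<in> dL ` ?L) * x u powi (s_exp v t u - 2))"
    unfolding deg prod.distrib by (simp add: mult.assoc)
  also have "(\<Prod>u\<in>?V. x u ^ of_bool (u \<in> bL ` ?L) * x u ^ of_bool (u \<in> dL ` ?L) * x u powi (s_exp v t u - 2)) =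
      (\<Prod>u\<in>?V. x u ^ of_bool (u \<in> Aodd) / x u ^ of_bool (u \<in> Aeven))"
  proof (rule prod.cong[OF refl])
    fix u assume u: "u \<in> ?V"
    have "x u ^ of_bool (u \<in> bL ` ?L) * x u ^ of_bool (u \<in> dL ` ?L) * x u powi (s_exp v t u - 2) =
        x u powi (of_bool (u \<in> bL ` ?L) + of_bool (u \<in> dL ` ?L) - 2 + s_exp v t u)"
      using split[OF u, of "of_bool (u \<in> bL ` ?L) + of_bool (u \<in> dL ` ?L)"] by (simp add: power_add)
    also have "\<dots> = x u powi (of_bool (u \<in> Aodd) - of_bool (u \<in> Aeven))"
      unfolding exponent[OF u] ..
    also have "\<dots> = x u ^ of_bool (u \<in> Aodd) / x u ^ of_bool (u \<in> Aeven)"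
      using nz[OF u] by (simp add: power_int_diff of_bool_def)
    finally show "x u ^ of_bool (u \<in> bL ` ?L) * x u ^ of_bool (u \<in> dL ` ?L) * x u powi (s_exp v t u - 2) =
      x u ^ of_bool (u \<in> Aodd) / x u ^ of_bool (u \<in> Aeven)" .
  qed
  also have "\<dots> = W x v t"
    unfolding prod_dividef W_sets prod_of_bool_subset[OF finite_Vert A_Vert(1)]
      prod_of_bool_subset[OF finite_Vert A_Vert(2)] ..
  finally show ?thesis .
qed

end

theorem theorem4p9:
  fixes v :: vec3 and t :: nat and x :: "vec3 \<Rightarrow> 'a::field"
  assumes "v \<in> P0" and "2 \<le> t" and "(int t + 1) mod 3 = color v"
    and "\<And>u. u \<in> P0 \<Longrightarrow> x u \<noteq> 0"
  shows "bij_betw (phi v t) (rooted_forests v t) (\<Union>r. boundary_rpaths v t r) \<and>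
    (\<forall>R\<in>rooted_forests v t.
       wt_forest x v t (fst R) = wt_arcs x (phi v t R) * W x v t)"
proof (intro conjI ballI)
  interpret region v t using assms(1-3) by unfold_locales
  show "bij_betw (phi v t) (rooted_forests v t) (\<Union>r. boundary_rpaths v t r)" by (rule phi_bij)
  fix R assume R: "R \<in> rooted_forests v t"
  obtain \<tau> where \<tau>: "tail_assignment v t \<tau>" "tails_of v t R \<tau>" using rooted_forest_tails[OF R] .
  interpret tails v t \<tau> by (rule region_tails[OF \<tau>(1)])
  show "wt_forest x v t (fst R) = wt_arcs x (phi v t R) * W x v t"
    using wt_forest_FE[of x, OF assms(4)] rooted_forest_eq[OF R \<tau>(2)] phi_tail_arcs[OF \<tau>(2)] by simp
qed

end
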